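(* Let $\{\lambda_n,\lambda_{n+1},\dots,\lambda_N\}$ be an arbitrary cluster of eigenvalues satisfying the standing assumption $\lambda_{h,n-1}<\lambda_n$ and $\lambda_N<\lambda_{h,N+1}$, and let $\mathcal{C}=\{n,\dots,N\}$. Then the quantity $\beta$ satisfies $$\beta \le \tau\,|\mathcal{C}|^{1/2}.$$ Further, if $$\tau_h\,\xi < 1-|\mathcal{C}|^{-1/2},$$ then $$\beta \le \frac{\tau}{1-\tau_h\,\xi}.$$
   Context: Let $\Omega\subset\mathbb{R}^d$ be a bounded Lipschitz polytope, $(\cdot,\cdot)$ and $\|\cdot\|$ the $L^2(\Omega)$ inner product and norm. Let $0<\lambda_1\le\lambda_2\le\cdots$ be the eigenvalues, repeated according to multiplicity, of the Dirichlet Laplacian in weak form: $(\nabla u_i,\nabla v)=\lambda_i(u_i,v)$ for all $v\in H^1_0(\Omega)$, with corresponding eigenfunctions $u_i\in H^1_0(\Omega)$ normalized by $(u_i,u_j)=\delta_{ij}$. Let $\mathcal{T}_h$ be a conforming simplicial mesh of $\Omega$ and $V_h=\{v_h\in H^1_0(\Omega): v_h|_K\in\mathbb{P}_p(K)\ \text{for all } K\in\mathcal{T}_h\}$, where $\mathbb{P}_p(K)$ is the space of polynomials on $K$ of degree at most $p$. Let $\lambda_{h,1}\le\lambda_{h,2}\le\cdots\le\lambda_{h,\dim V_h}$ (repeated according to multiplicity) and $u_{h,i}\in V_h$ be the exact discrete eigenpairs: $(\nabla u_{h,i},\nabla v_h)=\lambda_{h,i}(u_{h,i},v_h)$ for all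 $v_h\in V_h$, normalized by $(u_{h,i},u_{h,j})=\delta_{ij}$ and $(\nabla u_{h,i},\nabla u_{h,j})=\lambda_{h,i}\delta_{ij}$. Set $\mathcal{I}=\{1,2,\dots,\dim V_h\}$. A cluster is given by indices $1\le n\le N\le\dim V_h$ (the eigenvalues $\lambda_n,\dots,\lambda_N$ in it need not be equal); $\mathcal{C}=\{n,n+1,\dots,N\}$ and $|\mathcal{C}|=N-n+1$. Set $E=\operatorname{span}\{u_i:i\in\mathcal{C}\}$, $E_h=\operatorname{span}\{u_{h,i}:i\in\mathcal{C}\}$ and $E^B=\{u\in E:\|u\|=1\}$. Standing assumption: $\lambda_{h,n-1}<\lambda_n$ and $\lambda_N<\lambda_{h,N+1}$ (an inequality involving an index outside $\mathcal{I}$ is void). Define $$\tau=\max_{j\in\mathcal{C}}\max_{i\in\mathcal{I}\setminus\mathcal{C}}\frac{\lambda_j}{|\lambda_{h,i}-\lambda_j|},\qquad \tau_h=\max_{j\in\mathcal{C}}\max_{i\in\mathcal{I}\setminus\mathcal{C}}\frac{\lambda_{h,i}}{|\lambda_{h,i}-\lambda_j|},\qquad \xi=\frac{\lambda_N-\lambda_n}{\lambda_n}$$ (a maximum over the empty set is $0$). $P_h:H^1_0(\Omega)\to V_h$ is the energy projector, defined by $(\nabla(u-P_hu),\nabla v_h)=0$ for all $v_h\in V_h$. $\Pi_h^{\mathcal{C}}:H^1_0(\Omega)\to E_h$ is the $L^2(\Omega)$-orthogonal projector onto $E_h$. The quantity $\beta$ is the minimal number $\beta\ge 0$ such that $$\|(I-\Pi_h^{\mathcal{C}})P_hu\|\le\beta\max_{v\in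 E^B}\|v-P_hv\|\quad\text{for all }u\in E^B;$$ if $\|u-P_hu\|=0$ for all $u\in E^B$, then $\beta=0$ by definition. *)

theory Defs
  imports "HOL-Analysis.Analysis"
begin

definition square_integrable :: "('a::euclidean_space \<Rightarrow> 'b::euclidean_space) \<Rightarrow> bool" where
  "square_integrable f \<longleftrightarrow>
     f \<in> borel_measurable lborel \<and> integrable lborel (\<lambda>x. (norm (f x))\<^sup>2)"

lemma square_integrable_zero: "square_integrable (\<lambda>x. 0)"
  by (simp add: square_integrable_def)

lemma square_integrable_add:
  assumes "square_integrable f" "square_integrable g"
  shows "square_integrable (\<lambda>x. f x + g x)"
  unfolding square_integrable_def
proof
  show m: "(\<lambda>x. f x + g x) \<in> borel_measurable lborel"
    using assms by (auto simp: square_integrable_def)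
  have i: "integrable lborel (\<lambda>x. 2 * (norm (f x))\<^sup>2 + 2 * (norm (g x))\<^sup>2)"
    using assms by (auto simp: square_integrable_def)
  show "integrable lborel (\<lambda>x. (norm (f x + g x))\<^sup>2)"
  proof (rule Bochner_Integration.integrable_bound[OF i])
    show "(\<lambda>x. (norm (f x + g x))\<^sup>2) \<in> borel_measurable lborel"
      using m by measurable
    have "(norm (a + b))\<^sup>2 \<le> 2 * (norm a)\<^sup>2 + 2 * (norm b)\<^sup>2" for a b :: 'b
    proof -
      have "(norm (a + b))\<^sup>2 + (norm (a - b))\<^sup>2 = 2 * (norm a)\<^sup>2 + 2 * (norm b)\<^sup>2"
        by (simp add: power2_norm_eq_inner inner_add inner_diff)
      then show ?thesis
        using zero_le_power2[of "norm (a - b)"] by linarith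
    qed
    then show "AE x in lborel. norm ((norm (f x + g x))\<^sup>2)
        \<le> norm (2 * (norm (f x))\<^sup>2 + 2 * (norm (g x))\<^sup>2)"
      by (intro AE_I2) simp
  qed
qed

lemma square_integrable_scaleR:
  assumes "square_integrable f"
  shows "square_integrable (\<lambda>x. c *\<^sub>R f x)"
  using assms by (auto simp: square_integrable_def power_mult_distrib)

lemma square_integrable_uminus:
  "square_integrable f \<Longrightarrow> square_integrable (\<lambda>x. - f x)"
  using square_integrable_scaleR[of f "-1"] by simp

lemma square_integrable_diff:
  assumes "square_integrable f" "square_integrable g"
  shows "square_integrable (\<lambda>x. f x - g x)"
  using square_integrable_add[OF assms(1) square_integrable_uminus[OF assms(2)]] by simp

lemma square_integrable_inner:
  assumes "square_integrable f" "square_integrable g"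
  shows "integrable lborel (\<lambda>x. f x \<bullet> g x)"
proof -
  have i: "integrable lborel (\<lambda>x. (norm (f x + g x))\<^sup>2 - (norm (f x))\<^sup>2 - (norm (g x))\<^sup>2)"
    using square_integrable_add[OF assms] assms by (auto simp: square_integrable_def)
  have "(\<lambda>x. f x \<bullet> g x)
      = (\<lambda>x. ((norm (f x + g x))\<^sup>2 - (norm (f x))\<^sup>2 - (norm (g x))\<^sup>2) / 2)"
    by (rule ext) (simp add: power2_norm_eq_inner inner_add inner_commute)
  then show ?thesis
    using i by simp
qed

quotient_type (overloaded) ('a, 'b) l2 = "'a::euclidean_space \<Rightarrow> 'b::euclidean_space" /
  partial: "\<lambda>f g. square_integrable f \<and> square_integrable g \<and> (AE x in lborel. f x = g x)"
  morphisms l2_rep l2_class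
proof (rule part_equivpI)
  show "\<exists>f::'a \<Rightarrow> 'b. square_integrable f \<and> square_integrable f \<and> (AE x in lborel. f x = f x)"
    using square_integrable_zero by auto
  show "symp (\<lambda>(f::'a \<Rightarrow> 'b) g. square_integrable f \<and> square_integrable g
      \<and> (AE x in lborel. f x = g x))"
    by (auto intro!: sympI elim: AE_mp)
  show "transp (\<lambda>(f::'a \<Rightarrow> 'b) g. square_integrable f \<and> square_integrable g
      \<and> (AE x in lborel. f x = g x))"
  proof (rule transpI, intro conjI)
    fix f g h :: "'a \<Rightarrow> 'b"
    assume *: "square_integrable f \<and> square_integrable g \<and> (AE x in lborel. f x = g x)"
      "square_integrable g \<and> square_integrable h \<and> (AE x in lborel. g x = h x)"
    show "square_integrable f" "square_integrable h" using * by auto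
    have "AE x in lborel. f x = g x" "AE x in lborel. g x = h x" using * by auto
    then show "AE x in lborel. f x = h x" by eventually_elim simp
  qed
qed

instantiation l2 :: (euclidean_space, euclidean_space) real_vector
begin

lift_definition zero_l2 :: "('a, 'b) l2" is "\<lambda>x. 0"
  by (simp add: square_integrable_zero)

lift_definition plus_l2 :: "('a, 'b) l2 \<Rightarrow> ('a, 'b) l2 \<Rightarrow> ('a, 'b) l2" is "\<lambda>f g x. f x + g x"
  by (auto intro: square_integrable_add elim!: AE_mp)

lift_definition minus_l2 :: "('a, 'b) l2 \<Rightarrow> ('a, 'b) l2 \<Rightarrow> ('a, 'b) l2" is "\<lambda>f g x. f x - g x"
  by (auto intro: square_integrable_diff elim!: AE_mp)

lift_definition uminus_l2 :: "('a, 'b) l2 \<Rightarrow> ('a, 'b) l2" is "\<lambda>f x. - f x"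
  by (auto intro: square_integrable_uminus elim!: AE_mp)

lift_definition scaleR_l2 :: "real \<Rightarrow> ('a, 'b) l2 \<Rightarrow> ('a, 'b) l2" is "\<lambda>c f x. c *\<^sub>R f x"
  by (auto intro: square_integrable_scaleR elim!: AE_mp)

instance
proof
  fix a b c :: "('a, 'b) l2" and r s :: real
  show "a + b + c = a + (b + c)"
    by transfer (auto intro: square_integrable_add simp: add.assoc)
  show "a + b = b + a"
    by transfer (auto intro: square_integrable_add simp: add.commute)
  show "0 + a = a"
    by transfer auto
  show "- a + a = 0"
    by transfer (auto simp: square_integrable_zero)
  show "a - b = a + - b"
    by transfer (auto intro: square_integrable_diff square_integrable_add square_integrable_uminus)
  show "r *\<^sub>R (a + b) = r *\<^sub>R a + r *\<^sub>R b"
    by transfer (auto intro: square_integrable_add square_integrable_scaleR simp: scaleR_add_right)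
  show "(r + s) *\<^sub>R a = r *\<^sub>R a + s *\<^sub>R a"
    by transfer (auto intro: square_integrable_add square_integrable_scaleR simp: scaleR_add_left)
  show "r *\<^sub>R s *\<^sub>R a = (r * s) *\<^sub>R a"
    by transfer (auto intro: square_integrable_scaleR)
  show "1 *\<^sub>R a = a"
    by transfer auto
qed

end

instantiation l2 :: (euclidean_space, euclidean_space) real_inner
begin

lift_definition inner_l2 :: "('a, 'b) l2 \<Rightarrow> ('a, 'b) l2 \<Rightarrow> real"
  is "\<lambda>f g. integral\<^sup>L lborel (\<lambda>x. f x \<bullet> g x)"
proof -
  fix f g f' g' :: "'a \<Rightarrow> 'b"
  assume *: "square_integrable f \<and> square_integrable f' \<and> (AE x in lborel. f x = f' x)"
    "square_integrable g \<and> square_integrable g' \<and> (AE x in lborel. g x = g' x)"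
  show "integral\<^sup>L lborel (\<lambda>x. f x \<bullet> g x) = integral\<^sup>L lborel (\<lambda>x. f' x \<bullet> g' x)"
  proof (rule integral_cong_AE)
    show "(\<lambda>x. f x \<bullet> g x) \<in> borel_measurable lborel"
      "(\<lambda>x. f' x \<bullet> g' x) \<in> borel_measurable lborel"
      using * by (auto simp: square_integrable_def)
    have "AE x in lborel. f x = f' x" "AE x in lborel. g x = g' x" using * by auto
    then show "AE x in lborel. f x \<bullet> g x = f' x \<bullet> g' x" by eventually_elim simp
  qed
qed

definition norm_l2 :: "('a, 'b) l2 \<Rightarrow> real" where
  "norm_l2 f = sqrt (inner f f)"

definition dist_l2 :: "('a, 'b) l2 \<Rightarrow> ('a, 'b) l2 \<Rightarrow> real" where
  "dist_l2 f g = norm (f - g)"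

definition sgn_l2 :: "('a, 'b) l2 \<Rightarrow> ('a, 'b) l2" where
  "sgn_l2 f = f /\<^sub>R norm f"

definition uniformity_l2 :: "(('a, 'b) l2 \<times> ('a, 'b) l2) filter" where
  "uniformity_l2 = (INF e\<in>{0<..}. principal {(f, g). dist f g < e})"

definition open_l2 :: "('a, 'b) l2 set \<Rightarrow> bool" where
  "open_l2 U \<longleftrightarrow> (\<forall>f\<in>U. eventually (\<lambda>(f', g). f' = f \<longrightarrow> g \<in> U) uniformity)"

instance
proof
  fix f g h :: "('a, 'b) l2" and r :: real and U :: "('a, 'b) l2 set"
  show "dist f g = norm (f - g)" by (simp add: dist_l2_def)
  show "sgn f = f /\<^sub>R norm f" by (simp add: sgn_l2_def)
  show "(uniformity :: (('a, 'b) l2 \<times> ('a, 'b) l2) filter)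
      = (INF e\<in>{0<..}. principal {(f, g). dist f g < e})"
    by (simp add: uniformity_l2_def)
  show "open U = (\<forall>f\<in>U. eventually (\<lambda>(f', g). f' = f \<longrightarrow> g \<in> U) uniformity)"
    by (simp add: open_l2_def)
  show "inner f g = inner g f"
    by transfer (simp add: inner_commute)
  show "inner (f + g) h = inner f h + inner g h"
    by transfer (simp add: inner_add_left square_integrable_inner)
  show "inner (r *\<^sub>R f) g = r * inner f g"
    by transfer simp
  show "0 \<le> inner f f"
    by transfer simp
  show "inner f f = 0 \<longleftrightarrow> f = 0"
  proof transfer
    fix f :: "'a \<Rightarrow> 'b"
    assume *: "square_integrable f \<and> square_integrable f \<and> (AE x in lborel. f x = f x)"
    have "integral\<^sup>L lborel (\<lambda>x. f x \<bullet> f x) = 0 \<longleftrightarrow> (AE x in lborel. f x \<bullet> f x = 0)"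
      by (rule integral_nonneg_eq_0_iff_AE) (use * square_integrable_inner in auto)
    then show "(integral\<^sup>L lborel (\<lambda>x. f x \<bullet> f x) = 0) =
        (square_integrable f \<and> square_integrable (\<lambda>x. 0::'b) \<and> (AE x in lborel. f x = 0))"
      using * by (simp add: square_integrable_zero)
  qed
  show "norm f = sqrt (inner f f)" by (simp add: norm_l2_def)
qed

end

lift_definition ae_eq_on :: "'a::euclidean_space set \<Rightarrow> ('a, 'b::euclidean_space) l2 \<Rightarrow> ('a \<Rightarrow> 'b) \<Rightarrow> bool"
  is "\<lambda>S f g. AE x in lborel. x \<in> S \<longrightarrow> f x = g x"
proof (rule ext)
  fix S :: "'a set" and f f' g :: "'a \<Rightarrow> 'b"
  assume "square_integrable f \<and> square_integrable f' \<and> (AE x in lborel. f x = f' x)"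
  then have *: "AE x in lborel. f x = f' x" by simp
  show "(AE x in lborel. x \<in> S \<longrightarrow> f x = g x) = (AE x in lborel. x \<in> S \<longrightarrow> f' x = g x)"
    by (rule eventually_cong[OF *]) simp
qed

text \<open>
  \<open>L2 \<Omega>\<close> is realised inside the whole-space type by extending functions by zero, so the
  inner product and norm of the type restrict to those of \<open>\<Omega>\<close>.
\<close>

definition L2 :: "'a::euclidean_space set \<Rightarrow> ('a, 'b::euclidean_space) l2 set" where
  "L2 \<Omega> = {u. ae_eq_on (- \<Omega>) u (\<lambda>x. 0)}"

primrec Ck :: "nat \<Rightarrow> ('a::euclidean_space \<Rightarrow> real) \<Rightarrow> bool" where
  "Ck 0 f \<longleftrightarrow> continuous_on UNIV f"
| "Ck (Suc k) f \<longleftrightarrow> (\<forall>x. f differentiable (at x)) \<and>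
     (\<forall>i\<in>Basis. Ck k (\<lambda>x. frechet_derivative f (at x) i))"

definition test_functions :: "'a::euclidean_space set \<Rightarrow> ('a \<Rightarrow> real) set" where
  "test_functions \<Omega> = {\<phi>. (\<forall>k. Ck k \<phi>) \<and>
     compact (closure (support_on UNIV \<phi>)) \<and> closure (support_on UNIV \<phi>) \<subseteq> \<Omega>}"

definition weak_gradient ::
  "'a::euclidean_space set \<Rightarrow> ('a, real) l2 \<Rightarrow> ('a, 'a) l2 \<Rightarrow> bool" where
  "weak_gradient \<Omega> u g \<longleftrightarrow> u \<in> L2 \<Omega> \<and> g \<in> L2 \<Omega> \<and>
     (\<forall>\<phi>\<in>test_functions \<Omega>. \<forall>i\<in>Basis.
        u \<bullet> l2_class (\<lambda>x. frechet_derivative \<phi> (at x) i) = - (g \<bullet> l2_class (\<lambda>x. \<phi> x *\<^sub>R i)))"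

definition H1 :: "'a::euclidean_space set \<Rightarrow> ('a, real) l2 set" where
  "H1 \<Omega> = {u. \<exists>g. weak_gradient \<Omega> u g}"

definition grad :: "'a::euclidean_space set \<Rightarrow> ('a, real) l2 \<Rightarrow> ('a, 'a) l2" where
  "grad \<Omega> u = (THE g. weak_gradient \<Omega> u g)"

definition energy :: "'a::euclidean_space set \<Rightarrow> ('a, real) l2 \<Rightarrow> ('a, real) l2 \<Rightarrow> real" where
  "energy \<Omega> u v = grad \<Omega> u \<bullet> grad \<Omega> v"

definition H1_norm :: "'a::euclidean_space set \<Rightarrow> ('a, real) l2 \<Rightarrow> real" where
  "H1_norm \<Omega> u = sqrt ((norm u)\<^sup>2 + (norm (grad \<Omega> u))\<^sup>2)"

definition H10 :: "'a::euclidean_space set \<Rightarrow> ('a, real) l2 set" where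
  "H10 \<Omega> = {u \<in> H1 \<Omega>. \<forall>e>0. \<exists>\<phi>\<in>test_functions \<Omega>. H1_norm \<Omega> (u - l2_class \<phi>) < e}"

text \<open>Near every boundary point, in coordinates with axis \<open>e\<close>, the set is the strict
  epigraph of a Lipschitz function on the hyperplane orthogonal to \<open>e\<close>.\<close>

definition lipschitz_boundary :: "'a::euclidean_space set \<Rightarrow> bool" where
  "lipschitz_boundary \<Omega> \<longleftrightarrow> (\<forall>x\<in>frontier \<Omega>. \<exists>U e L \<gamma>.
     open U \<and> x \<in> U \<and> norm e = 1 \<and> L-lipschitz_on {z. z \<bullet> e = 0} \<gamma> \<and>
     \<Omega> \<inter> U = {y \<in> U. \<gamma> (y - (y \<bullet> e) *\<^sub>R e) < y \<bullet> e})"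

text \<open>The library's \<open>polytope\<close> means a convex polytope; here \<open>\<Omega>\<close> need not be convex.\<close>

definition lipschitz_polytope :: "'a::euclidean_space set \<Rightarrow> bool" where
  "lipschitz_polytope \<Omega> \<longleftrightarrow> open \<Omega> \<and> bounded \<Omega> \<and> \<Omega> \<noteq> {} \<and>
     (\<exists>\<P>. finite \<P> \<and> (\<forall>P\<in>\<P>. polytope P) \<and> closure \<Omega> = \<Union>\<P>) \<and> lipschitz_boundary \<Omega>"

definition conforming_mesh :: "'a::euclidean_space set \<Rightarrow> 'a set set \<Rightarrow> bool" where
  "conforming_mesh \<Omega> \<T> \<longleftrightarrow> triangulation \<T> \<and> (\<forall>K\<in>\<T>. int DIM('a) simplex K) \<and>
     \<Union>\<T> = closure \<Omega>"

text \<open>Polynomials of total degree at most \<open>p\<close>; \<open>\<alpha>\<close> ranges over multi-indices.\<close>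

definition polys :: "nat \<Rightarrow> ('a::euclidean_space \<Rightarrow> real) set" where
  "polys p = {q. \<exists>c. q = (\<lambda>x. \<Sum>\<alpha> | \<alpha> \<in> Basis \<rightarrow>\<^sub>E UNIV \<and> sum \<alpha> Basis \<le> p.
     c \<alpha> * (\<Prod>i\<in>Basis. (x \<bullet> i) ^ \<alpha> i))}"

definition fe_space :: "'a::euclidean_space set \<Rightarrow> 'a set set \<Rightarrow> nat \<Rightarrow> ('a, real) l2 set" where
  "fe_space \<Omega> \<T> p = {v \<in> H10 \<Omega>. \<forall>K\<in>\<T>. \<exists>q\<in>polys p. ae_eq_on K v q}"

text \<open>Eigenpairs are indexed from 1; \<open>lam 0\<close> and \<open>u 0\<close> play no role. The last clause says that every eigenvalue occurs with
  its full multiplicity.\<close>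

definition dirichlet_eigenpairs ::
  "'a::euclidean_space set \<Rightarrow> (nat \<Rightarrow> real) \<Rightarrow> (nat \<Rightarrow> ('a, real) l2) \<Rightarrow> bool" where
  "dirichlet_eigenpairs \<Omega> lam u \<longleftrightarrow>
     (\<forall>i\<ge>1. 0 < lam i) \<and>
     (\<forall>i\<ge>1. \<forall>j\<ge>i. lam i \<le> lam j) \<and>
     (\<forall>i\<ge>1. u i \<in> H10 \<Omega> \<and> (\<forall>v\<in>H10 \<Omega>. energy \<Omega> (u i) v = lam i * (u i \<bullet> v))) \<and>
     (\<forall>i\<ge>1. \<forall>j\<ge>1. u i \<bullet> u j = (if i = j then 1 else 0)) \<and>
     (\<forall>\<mu>. \<forall>w\<in>H10 \<Omega>. (\<forall>v\<in>H10 \<Omega>. energy \<Omega> w v = \<mu> * (w \<bullet> v)) \<longrightarrow>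
        w \<in> span {u i | i. 1 \<le> i \<and> lam i = \<mu>})"

definition discrete_eigenpairs ::
  "'a::euclidean_space set \<Rightarrow> ('a, real) l2 set \<Rightarrow> (nat \<Rightarrow> real) \<Rightarrow> (nat \<Rightarrow> ('a, real) l2) \<Rightarrow> bool" where
  "discrete_eigenpairs \<Omega> V lamh uh \<longleftrightarrow>
     (\<forall>i\<in>{1..dim V}. \<forall>j\<in>{1..dim V}. i \<le> j \<longrightarrow> lamh i \<le> lamh j) \<and>
     (\<forall>i\<in>{1..dim V}. uh i \<in> V \<and> (\<forall>v\<in>V. energy \<Omega> (uh i) v = lamh i * (uh i \<bullet> v))) \<and>
     (\<forall>i\<in>{1..dim V}. \<forall>j\<in>{1..dim V}. uh i \<bullet> uh j = (if i = j then 1 else 0)) \<and>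
     (\<forall>i\<in>{1..dim V}. \<forall>j\<in>{1..dim V}.
        energy \<Omega> (uh i) (uh j) = (if i = j then lamh i else 0))"

text \<open>The \<open>b\<close>-orthogonal projection onto \<open>V\<close>; it is well defined when \<open>b\<close> is positive definite
  on the finite-dimensional space \<open>V\<close>.\<close>

definition form_proj :: "('v::real_vector \<Rightarrow> 'v \<Rightarrow> real) \<Rightarrow> 'v set \<Rightarrow> 'v \<Rightarrow> 'v" where
  "form_proj b V u = (THE w. w \<in> V \<and> (\<forall>v\<in>V. b (u - w) v = 0))"

abbreviation energy_proj ::
  "'a::euclidean_space set \<Rightarrow> ('a, real) l2 set \<Rightarrow> ('a, real) l2 \<Rightarrow> ('a, real) l2" where
  "energy_proj \<Omega> V \<equiv> form_proj (energy \<Omega>) V"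

abbreviation L2_proj :: "('a::euclidean_space, real) l2 set \<Rightarrow> ('a, real) l2 \<Rightarrow> ('a, real) l2" where
  "L2_proj V \<equiv> form_proj inner V"

definition unit_sphere_of :: "'v::real_normed_vector set \<Rightarrow> 'v set" where
  "unit_sphere_of E = {u \<in> E. norm u = 1}"

text \<open>The supremum below is attained when \<open>E\<close> is finite-dimensional and nontrivial, because
  then the unit sphere of \<open>E\<close> is compact and nonempty.\<close>

definition beta ::
  "'a::euclidean_space set \<Rightarrow> ('a, real) l2 set \<Rightarrow> ('a, real) l2 set \<Rightarrow> ('a, real) l2 set \<Rightarrow> real" where
  "beta \<Omega> V E Eh =
     (let P = energy_proj \<Omega> V; EB = unit_sphere_of E in
      if \<forall>u\<in>EB. norm (u - P u) = 0 then 0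
      else LEAST b. 0 \<le> b \<and>
        (\<forall>u\<in>EB. norm (P u - L2_proj Eh (P u)) \<le> b * (SUP v\<in>EB. norm (v - P v))))"

definition Max0 :: "real set \<Rightarrow> real" where
  "Max0 S = (if S = {} then 0 else Max S)"

definition tau :: "(nat \<Rightarrow> real) \<Rightarrow> (nat \<Rightarrow> real) \<Rightarrow> nat set \<Rightarrow> nat set \<Rightarrow> real" where
  "tau lam lamh I C = Max0 {lam j / \<bar>lamh i - lam j\<bar> | j i. j \<in> C \<and> i \<in> I - C}"

definition tau_h :: "(nat \<Rightarrow> real) \<Rightarrow> (nat \<Rightarrow> real) \<Rightarrow> nat set \<Rightarrow> nat set \<Rightarrow> real" where
  "tau_h lam lamh I C = Max0 {lamh i / \<bar>lamh i - lam j\<bar> | j i. j \<in> C \<and> i \<in> I - C}"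

definition xi :: "(nat \<Rightarrow> real) \<Rightarrow> nat \<Rightarrow> nat \<Rightarrow> real" where
  "xi lam n N = (lam N - lam n) / lam n"

end

theory Submission
  imports Defs
begin

text \<open>
  Let \<open>P\<close> be the energy projection onto \<open>V\<close> and \<open>Q\<close> the \<open>L2\<close> projection onto \<open>Eh\<close>. For \<open>z\<close>
  in \<open>E\<close> the residual \<open>P z - Q (P z)\<close> consists of the components of \<open>P z\<close> along the
  discrete eigenvectors \<open>uh i\<close> with \<open>i\<close> outside the cluster. For an exact eigenvector the two
  eigenvalue equations give
  \<open>(lamh i - lam j) * (P (u j) \<bullet> uh i) = lam j * ((u j - P (u j)) \<bullet> uh i)\<close>, so by Bessel's inequality
  its residual is at most \<open>tau\<close> times its projection error. Adding this up over the cluster with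
  Cauchy--Schwarz costs the factor \<open>sqrt (card C)\<close> and gives the first bound
  (\<open>residual_bound_crude\<close>).

  For the second bound the cluster is treated as a perturbation of a multiple eigenvalue \<open>lam n\<close>.
  For a unit vector \<open>z = (\<Sum>j\<in>C. c j *\<^sub>R u j)\<close> and the vector \<open>y\<close> with coefficients
  \<open>c j * (lam j - lam n) / lam j\<close> one has
  \<open>(lamh i - lam n) * (P z \<bullet> uh i) = lam n * ((z - P z) \<bullet> uh i) + lamh i * (P y \<bullet> uh i)\<close>, where \<open>y\<close>
  lies in \<open>E\<close> and has norm at most \<open>xi\<close>. If \<open>S\<close> is the supremum of the residuals over the unit sphere
  of \<open>E\<close> and \<open>m\<close> that of the projection errors, this yields \<open>S \<le> tau * m + tau_h * xi * S\<close>. The first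
  bound shows that \<open>S\<close> is finite, and solving for \<open>S\<close> gives the claim
  (\<open>cluster_identity\<close>, \<open>residual_bound_sharp\<close>).

  This argument is abstract linear algebra (\<open>ritz_cluster\<close>). It applies because the energy is a bilinear
  form, positive definite on \<open>H10 \<Omega>\<close>, and \<open>V\<close> is a linear space spanned by the \<open>uh i\<close>. For the weakly defined gradient, linearity rests on its
  uniqueness, that is, on the fundamental lemma of the calculus of variations, proved here with
  explicit smooth bumps that approximate indicator functions of boxes. For \<open>H10 \<Omega>\<close> to be a linear
  space the test functions must have weak gradients, which is integration by parts. Positive
  definiteness follows from the completeness of the list of exact eigenpairs.
\<close>

section \<open>Functions of class \<open>Ck\<close>\<close>

lemma Ck_imp_continuous: "Ck k f \<Longrightarrow> continuous_on UNIV f"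
  by (cases k) (auto intro!: continuous_at_imp_continuous_on differentiable_imp_continuous_within)

lemma Ck_Suc_imp: "Ck (Suc k) f \<Longrightarrow> Ck k f"
proof (induction k arbitrary: f)
  case 0
  then show ?case using Ck_imp_continuous by (metis Ck.simps(1))
next
  case (Suc k)
  then show ?case by (metis Ck.simps(2))
qed

lemma frechet_derivative_eq:
  "(f has_derivative F) (at x) \<Longrightarrow> frechet_derivative f (at x) = F"
  by (metis frechet_derivative_at)

lemma has_frechet_derivative:
  "f differentiable (at x) \<Longrightarrow> (f has_derivative frechet_derivative f (at x)) (at x)"
  by (simp add: frechet_derivative_works)

lemma Ck_const: "Ck k (\<lambda>x. c)"
proof (induction k arbitrary: c)
  case (Suc k)
  have "frechet_derivative (\<lambda>x::'a. c) (at x) = (\<lambda>i. 0)" for x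
    by (rule frechet_derivative_eq) auto
  then show ?case using Suc by simp
qed simp

lemma Ck_add: "Ck k f \<Longrightarrow> Ck k g \<Longrightarrow> Ck k (\<lambda>x. f x + g x)"
proof (induction k arbitrary: f g)
  case 0
  then show ?case by (auto intro!: continuous_intros)
next
  case (Suc k)
  have "frechet_derivative (\<lambda>x. f x + g x) (at x)
      = (\<lambda>i. frechet_derivative f (at x) i + frechet_derivative g (at x) i)" for x
    using Suc.prems by (intro frechet_derivative_eq has_derivative_add has_frechet_derivative) auto
  then show ?case using Suc by auto
qed

lemma Ck_mult: "Ck k f \<Longrightarrow> Ck k g \<Longrightarrow> Ck k (\<lambda>x. f x * g x)"
proof (induction k arbitrary: f g)
  case 0
  then show ?case by (auto intro!: continuous_intros)
next
  case (Suc k)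
  have *: "frechet_derivative (\<lambda>x. f x * g x) (at x)
      = (\<lambda>i. f x * frechet_derivative g (at x) i + frechet_derivative f (at x) i * g x)" for x
    using Suc.prems by (intro frechet_derivative_eq has_derivative_mult has_frechet_derivative) auto
  have "Ck k f" "Ck k g" using Suc.prems by (auto intro: Ck_Suc_imp)
  then show ?case using Suc by (auto simp: * intro!: Ck_add)
qed

lemma Ck_scale: "Ck k f \<Longrightarrow> Ck k (\<lambda>x. c * f x)"
  by (intro Ck_mult Ck_const)

lemma Ck_prod: "finite A \<Longrightarrow> (\<And>i. i \<in> A \<Longrightarrow> Ck k (f i)) \<Longrightarrow> Ck k (\<lambda>x. \<Prod>i\<in>A. f i x)"
  by (induction A rule: finite_induct) (auto intro: Ck_const Ck_mult)

section \<open>Test functions\<close>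

lemma continuous_compact_support_integrable:
  fixes f :: "'a::euclidean_space \<Rightarrow> real"
  assumes "continuous_on UNIV f" "compact K" "\<And>x. x \<notin> K \<Longrightarrow> f x = 0"
  shows "integrable lborel f"
proof -
  have "integrable lborel (\<lambda>x. indicator K x *\<^sub>R f x)"
    using borel_integrable_compact[OF assms(2), of f] continuous_on_subset[OF assms(1)]
    by (simp add: indicator_def if_distrib cong: if_cong)
  moreover have "(\<lambda>x. indicator K x *\<^sub>R f x) = f"
    using assms(3) by (force simp: indicator_def)
  ultimately show ?thesis by simp
qed

lemma test_functionD:
  assumes "\<phi> \<in> test_functions \<Omega>"
  shows "Ck k \<phi>" "continuous_on UNIV \<phi>" "\<phi> differentiable (at x)"
    "compact (closure (support_on UNIV \<phi>))" "closure (support_on UNIV \<phi>) \<subseteq> \<Omega>"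
    "i \<in> Basis \<Longrightarrow> continuous_on UNIV (\<lambda>x. frechet_derivative \<phi> (at x) i)"
proof -
  show *: "Ck k \<phi>" for k using assms by (auto simp: test_functions_def)
  show "continuous_on UNIV \<phi>" using *[of 0] by simp
  show "\<phi> differentiable (at x)" using *[of 1] by simp
  show "compact (closure (support_on UNIV \<phi>))" "closure (support_on UNIV \<phi>) \<subseteq> \<Omega>"
    using assms by (auto simp: test_functions_def)
  show "i \<in> Basis \<Longrightarrow> continuous_on UNIV (\<lambda>x. frechet_derivative \<phi> (at x) i)"
    using *[of 1] by simp
qed

lemma test_functionI:
  assumes "\<And>k. Ck k \<phi>" "compact K" "K \<subseteq> \<Omega>" "\<And>x. x \<notin> K \<Longrightarrow> \<phi> x = 0"
  shows "\<phi> \<in> test_functions \<Omega>"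
proof -
  have "closure (support_on UNIV \<phi>) \<subseteq> K"
    using assms(2,4) by (intro closure_minimal) (auto simp: support_on_def compact_imp_closed)
  moreover have "compact (closure (support_on UNIV \<phi>))"
    using assms(2,4) unfolding compact_closure
    by (intro bounded_subset[OF compact_imp_bounded[OF assms(2)]]) (auto simp: support_on_def)
  ultimately show ?thesis
    using assms by (auto simp: test_functions_def)
qed

text \<open>The complement of the support is open, so a test function vanishes near each of its points and its
derivative vanishes there as well.\<close>

lemma outside_support:
  assumes "x \<notin> closure (support_on UNIV \<phi>)"
  shows "\<phi> x = 0" "frechet_derivative \<phi> (at x) = (\<lambda>i. 0)"
proof -
  have z: "\<phi> y = 0" if "y \<in> - closure (support_on UNIV \<phi>)" for y
    using that closure_subset[of "support_on UNIV \<phi>"] by (auto simp: support_on_def)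
  then show "\<phi> x = 0" using assms by simp
  have "(\<phi> has_derivative (\<lambda>i. 0)) (at x)"
    by (rule has_derivative_transform_within_open
        [where f = "\<lambda>x. 0" and s = "- closure (support_on UNIV \<phi>)"])
       (use assms z in auto)
  then show "frechet_derivative \<phi> (at x) = (\<lambda>i. 0)" by (rule frechet_derivative_eq)
qed

lemma square_integrable_continuous_compact_support:
  fixes f :: "'a::euclidean_space \<Rightarrow> real"
  assumes "continuous_on UNIV f" "compact K" "\<And>x. x \<notin> K \<Longrightarrow> f x = 0"
  shows "square_integrable f"
  unfolding square_integrable_def
proof
  show "f \<in> borel_measurable lborel"
    using borel_measurable_continuous_onI[OF assms(1)] by simp
  have "continuous_on UNIV (\<lambda>x. (norm (f x))\<^sup>2)"
    by (intro continuous_intros assms(1))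
  then show "integrable lborel (\<lambda>x. (norm (f x))\<^sup>2)"
    by (rule continuous_compact_support_integrable[OF _ assms(2)]) (simp add: assms(3))
qed

lemma square_integrable_test_function:
  assumes "\<phi> \<in> test_functions \<Omega>"
  shows "square_integrable \<phi>"
  using square_integrable_continuous_compact_support[OF test_functionD(2,4)[OF assms]]
    outside_support by blast

lemma square_integrable_scaleR_vector:
  assumes "square_integrable (f :: 'a::euclidean_space \<Rightarrow> real)"
  shows "square_integrable (\<lambda>x. f x *\<^sub>R (w::'b::euclidean_space))"
  using assms by (auto simp: square_integrable_def power_mult_distrib)

lemma square_integrable_deriv_test_function:
  assumes "\<phi> \<in> test_functions \<Omega>" "i \<in> Basis"
  shows "square_integrable (\<lambda>x. frechet_derivative \<phi> (at x) i)"
  using square_integrable_continuous_compact_support[OF test_functionD(6)[OF assms] test_functionD(4)[OF assms(1)]]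
    outside_support(2)[of _ \<phi>] by simp

section \<open>Smooth bumps\<close>

text \<open>The case \<open>k = 0\<close> is the classical smooth function that is positive exactly on the positive
half-line. The powers \<open>(1 / t) ^ k\<close> are included because the family is then closed under
differentiation up to linear combinations, which turns smoothness into an induction.\<close>

definition flat :: "nat \<Rightarrow> real \<Rightarrow> real" where
  "flat k t = (if t \<le> 0 then 0 else (1 / t) ^ k * exp (- (1 / t)))"

lemma tendsto_flat_0: "(flat k \<longlongrightarrow> 0) (at 0)"
proof -
  have "((\<lambda>t. (1 / t) ^ k / exp (1 / t)) \<longlongrightarrow> (0::real)) (at_right 0)"
    by (rule filterlim_compose[OF tendsto_power_div_exp_0])
       (use filterlim_inverse_at_top_right in \<open>simp add: inverse_eq_divide\<close>)
  moreover have "\<forall>\<^sub>F t in at_right 0. (1 / t) ^ k / exp (1 / t) = flat k t"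
    by (auto simp: eventually_at_filter flat_def exp_minus divide_inverse)
  ultimately have "(flat k \<longlongrightarrow> 0) (at_right 0)"
    by (rule Lim_transform_eventually)
  moreover have "(flat k \<longlongrightarrow> 0) (at_left 0)"
    by (rule Lim_transform_eventually[OF tendsto_const])
       (auto simp: eventually_at_filter flat_def)
  ultimately show ?thesis by (simp add: filterlim_at_split)
qed

lemma flat_has_derivative:
  "(flat k has_real_derivative flat (k + 2) t - real k * flat (k + 1) t) (at t)"
proof (cases "t = 0")
  case True
  \<comment> \<open>The difference quotient at \<open>0\<close> is the next member of the family, so differentiability at
  \<open>0\<close> is the limit just computed.\<close>
  have "(\<lambda>h. (flat k (0 + h) - flat k 0) / h) = flat (k + 1)"
    by (rule ext) (auto simp: flat_def)
  then show ?thesis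
    using tendsto_flat_0[of "k + 1"] True by (simp add: DERIV_def flat_def)
next
  case False
  show ?thesis
  proof (cases "t < 0")
    case True
    have "((\<lambda>t. 0) has_real_derivative 0) (at t)" by simp
    then have "(flat k has_real_derivative 0) (at t)"
      by (rule has_field_derivative_transform_within_open[where S = "{..<0}"])
         (use True in \<open>auto simp: flat_def\<close>)
    then show ?thesis using True by (simp add: flat_def)
  next
    case F: False
    then have t: "t > 0" using False by simp
    have "((\<lambda>t. (1 / t) ^ k * exp (- (1 / t))) has_real_derivative
        (1 / t) ^ k * (exp (- (1 / t)) * (1 / t ^ 2))
        + real k * (1 / t) ^ (k - 1) * (- 1 / t ^ 2) * exp (- (1 / t))) (at t)"
      using t by (auto intro!: derivative_eq_intros simp: power2_eq_square)
    moreover have "(1 / t) ^ k * (exp (- (1 / t)) * (1 / t ^ 2))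
        + real k * (1 / t) ^ (k - 1) * (- 1 / t ^ 2) * exp (- (1 / t))
      = flat (k + 2) t - real k * flat (k + 1) t"
      using t by (cases k) (auto simp: flat_def field_simps power2_eq_square)
    ultimately have "((\<lambda>t. (1 / t) ^ k * exp (- (1 / t))) has_real_derivative
       flat (k + 2) t - real k * flat (k + 1) t) (at t)" by simp
    then show ?thesis
      by (rule has_field_derivative_transform_within_open[where S = "{0<..}"])
         (use t in \<open>auto simp: flat_def\<close>)
  qed
qed

lemma Ck_flat: "Ck m (\<lambda>x::'a::euclidean_space. flat k (x \<bullet> w + c))"
proof (induction m arbitrary: k)
  case 0
  have "continuous_on UNIV (flat k)"
    by (rule DERIV_continuous_on) (rule flat_has_derivative[THEN has_field_derivative_at_within])
  then have "continuous_on UNIV (\<lambda>x::'a. flat k (x \<bullet> w + c))"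
    by (rule continuous_on_compose2) (auto intro!: continuous_intros)
  then show ?case by simp
next
  case (Suc m)
  have d: "((\<lambda>x::'a. flat k (x \<bullet> w + c)) has_derivative
      (\<lambda>j. (flat (k + 2) (x \<bullet> w + c) - real k * flat (k + 1) (x \<bullet> w + c)) * (j \<bullet> w))) (at x)" for x
    by (rule has_derivative_compose[of "\<lambda>x. x \<bullet> w + c" "\<lambda>j. j \<bullet> w" _ _ "flat k"])
       (use flat_has_derivative[of k] in
         \<open>auto intro!: derivative_eq_intros simp: has_field_derivative_def\<close>)
  have "Ck m (\<lambda>x::'a. (j \<bullet> w) * (flat (k + 2) (x \<bullet> w + c)
      + - real k * flat (k + 1) (x \<bullet> w + c)))" for j
    by (intro Ck_scale Ck_add Suc)
  then show ?case
    by (auto simp: frechet_derivative_eq[OF d] mult.commute intro!: differentiableI d)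
qed

text \<open>A smooth approximation from below of the indicator function of the open box. The shift by \<open>1\<close>
in the arguments moves the support to distance \<open>1 / n\<close> from the faces, so that \<open>bump a b n\<close> is a
test function on every set containing the open box, even if the closed box is not inside that set.\<close>

definition bump :: "'a::euclidean_space \<Rightarrow> 'a \<Rightarrow> nat \<Rightarrow> 'a \<Rightarrow> real" where
  "bump a b n x = (\<Prod>i\<in>Basis. flat 0 (real n * (x \<bullet> i - a \<bullet> i) - 1)
     * flat 0 (real n * (b \<bullet> i - x \<bullet> i) - 1))"

lemma flat_0_bounds: "0 \<le> flat 0 t" "flat 0 t \<le> 1" "t \<le> 0 \<Longrightarrow> flat 0 t = 0"
  by (auto simp: flat_def)

lemma Ck_bump: "Ck k (bump a b n)"
proof -
  have 1: "real n * (x \<bullet> i - a \<bullet> i) - 1 = x \<bullet> (real n *\<^sub>R i) + (- real n * (a \<bullet> i) - 1)"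
    and 2: "real n * (b \<bullet> i - x \<bullet> i) - 1 = x \<bullet> (- real n *\<^sub>R i) + (real n * (b \<bullet> i) - 1)"
    for x i by (simp_all add: algebra_simps)
  show ?thesis
    unfolding bump_def[abs_def] 1 2 by (intro Ck_prod Ck_mult Ck_flat finite_Basis)
qed

lemma bump_outside:
  assumes "n > 0" "x \<notin> cbox (a + (\<Sum>i\<in>Basis. (1 / real n) *\<^sub>R i)) (b - (\<Sum>i\<in>Basis. (1 / real n) *\<^sub>R i))"
  shows "bump a b n x = 0"
proof -
  obtain i where i: "i \<in> Basis" "x \<bullet> i < a \<bullet> i + 1 / real n \<or> b \<bullet> i - 1 / real n < x \<bullet> i"
    using assms(2) by (auto simp: mem_box inner_add_left inner_diff_left not_le)
  have "real n * (x \<bullet> i - a \<bullet> i) - 1 \<le> 0 \<or> real n * (b \<bullet> i - x \<bullet> i) - 1 \<le> 0"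
    using i(2) assms(1) by (auto simp: field_simps)
  then show ?thesis
    unfolding bump_def using i(1) by (auto intro!: bexI[of _ i] simp: flat_0_bounds(3))
qed

lemma bump_bounds: "0 \<le> bump a b n x" "bump a b n x \<le> 1"
  unfolding bump_def
  by (auto intro!: prod_nonneg prod_le_1 mult_nonneg_nonneg mult_le_one simp: flat_0_bounds)

lemma bump_test_function:
  assumes "box a b \<subseteq> \<Omega>" "n > 0"
  shows "bump a b n \<in> test_functions \<Omega>"
proof (rule test_functionI[OF Ck_bump compact_cbox _ bump_outside[OF assms(2)]])
  have "0 < 1 / real n" using assms(2) by simp
  then have "s < t" if "s + 1 / real n \<le> t" for s t using that by linarith
  then show "cbox (a + (\<Sum>i\<in>Basis. (1 / real n) *\<^sub>R i)) (b - (\<Sum>i\<in>Basis. (1 / real n) *\<^sub>R i)) \<subseteq> \<Omega>"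
    by (intro order.trans[OF _ assms(1)])
      (auto simp: mem_box inner_add_left inner_diff_left le_diff_eq)
qed

lemma bump_eq_0:
  assumes "x \<notin> box a b"
  shows "bump a b n x = 0"
proof -
  obtain i where i: "i \<in> Basis" "x \<bullet> i \<le> a \<bullet> i \<or> b \<bullet> i \<le> x \<bullet> i"
    using assms by (auto simp: mem_box not_less)
  have "real n * (x \<bullet> i - a \<bullet> i) - 1 \<le> 0 \<or> real n * (b \<bullet> i - x \<bullet> i) - 1 \<le> 0"
    using i(2) mult_nonneg_nonpos[of "real n" "x \<bullet> i - a \<bullet> i"]
      mult_nonneg_nonpos[of "real n" "b \<bullet> i - x \<bullet> i"] by auto
  then show ?thesis
    unfolding bump_def using i(1) by (auto intro!: bexI[of _ i] simp: flat_0_bounds(3))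
qed

lemma flat_0_limit:
  assumes "t > 0"
  shows "(\<lambda>n. flat 0 (real n * t - 1)) \<longlonglongrightarrow> 1"
proof -
  have l: "filterlim (\<lambda>n. real n * t - 1) at_top sequentially"
    using filterlim_tendsto_add_at_top[OF tendsto_const[of "- 1"]
      filterlim_at_top_mult_tendsto_pos[OF tendsto_const assms filterlim_real_sequentially]]
    by (simp add: mult.commute)
  have "((\<lambda>s. exp (- (1 / s))) \<longlongrightarrow> exp (- 0)) (at_top :: real filter)"
    by (intro tendsto_intros tendsto_divide_0[OF tendsto_const] filterlim_at_top_imp_at_infinity
        filterlim_ident)
  moreover have "\<forall>\<^sub>F s in at_top. exp (- (1 / s)) = flat 0 s"
    using eventually_gt_at_top[of 0] by eventually_elim (simp add: flat_def)
  ultimately have "(flat 0 \<longlongrightarrow> 1) at_top"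
    using Lim_transform_eventually by fastforce
  then show ?thesis by (rule filterlim_compose[OF _ l])
qed

text \<open>At a point of the box every argument of \<open>flat 0\<close> tends to infinity, where \<open>flat 0\<close> tends to \<open>1\<close>;
at any other point all bumps vanish.\<close>

lemma bump_tendsto: "(\<lambda>n. bump a b n x) \<longlonglongrightarrow> indicator (box a b) x"
proof (cases "x \<in> box a b")
  case True
  have "(\<lambda>n. bump a b n x) \<longlonglongrightarrow> (\<Prod>i\<in>(Basis::'a set). 1 * 1)"
    unfolding bump_def using True by (intro tendsto_prod tendsto_mult flat_0_limit) (auto simp: mem_box)
  then show ?thesis using True by simp
next
  case False
  then show ?thesis by (simp add: bump_eq_0)
qed

section \<open>The fundamental lemma of the calculus of variations\<close>

lemma set_integral_box_zero:
  fixes h :: "'a::euclidean_space \<Rightarrow> real"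
  assumes h: "h \<in> borel_measurable borel" "set_integrable lborel (box a b) h"
    and ab: "box a b \<subseteq> \<Omega>"
    and orth: "\<And>\<phi>. \<phi> \<in> test_functions \<Omega> \<Longrightarrow> (LINT x|lborel. h x * \<phi> x) = 0"
  shows "(LINT x:box a b|lborel. h x) = 0"
proof -
  have "(\<lambda>n. LINT x|lborel. h x * bump a b n x) \<longlonglongrightarrow> (LINT x|lborel. h x * indicator (box a b) x)"
  proof (rule integral_dominated_convergence[where w = "\<lambda>x. norm (indicator (box a b) x *\<^sub>R h x)"])
    have "bump a b n \<in> borel_measurable borel" for n
      using Ck_imp_continuous[OF Ck_bump] by (rule borel_measurable_continuous_onI)
    then show "(\<lambda>x. h x * bump a b n x) \<in> borel_measurable lborel" for n
      using h by simp
    show "(\<lambda>x. h x * indicator (box a b) x) \<in> borel_measurable lborel"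
      using h by simp
    show "integrable lborel (\<lambda>x. norm (indicator (box a b) x *\<^sub>R h x))"
      using h(2) by (simp add: set_integrable_def integrable_norm)
    show "AE x in lborel. (\<lambda>n. h x * bump a b n x) \<longlonglongrightarrow> h x * indicator (box a b) x"
      by (intro AE_I2 tendsto_intros bump_tendsto)
    show "AE x in lborel. norm (h x * bump a b n x) \<le> norm (indicator (box a b) x *\<^sub>R h x)" for n
    proof (rule AE_I2)
      fix x
      show "norm (h x * bump a b n x) \<le> norm (indicator (box a b) x *\<^sub>R h x)"
        using bump_bounds[of a b n x] bump_eq_0[of x a b n]
        by (cases "x \<in> box a b") (auto simp: abs_mult intro: mult_left_le)
    qed
  qed
  moreover have "\<forall>\<^sub>F n in sequentially. (LINT x|lborel. h x * bump a b n x) = 0"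
    using eventually_gt_at_top[of 0] by eventually_elim (intro orth bump_test_function ab)
  ultimately have "(\<lambda>n. 0) \<longlonglongrightarrow> (LINT x|lborel. h x * indicator (box a b) x)"
    by (rule Lim_transform_eventually)
  then have "(LINT x|lborel. h x * indicator (box a b) x) = 0"
    by (simp add: LIMSEQ_const_iff)
  then show ?thesis by (simp add: set_lebesgue_integral_def mult.commute)
qed

lemma box_Int_box_is_box: "\<exists>p q. box a b \<inter> box c d = box p q"
  by (rule exI)+ (rule box_Int_box)

text \<open>Boxes form an intersection-stable generator of the Borel sets, so Dynkin's argument extends
vanishing integrals from boxes to all Borel sets. The total integral is assumed to vanish because
complements are taken in the whole space.\<close>

lemma AE_zero_if_box_integrals_zero:
  fixes f :: "'a::euclidean_space \<Rightarrow> real"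
  assumes f: "integrable lborel f" "(LINT x|lborel. f x) = 0"
    and box0: "\<And>c d. (LINT x:box c d|lborel. f x) = 0"
  shows "AE x in lborel. f x = 0"
proof (rule density_unique_real[OF f(1)])
  show "integrable lborel (\<lambda>x::'a. 0::real)" by simp
  fix A :: "'a set" assume "A \<in> sets lborel"
  then have A: "A \<in> sigma_sets UNIV (range (\<lambda>(a, b). box a b :: 'a set))"
    by (simp add: borel_eq_box)
  have sub: "B \<in> sets lborel" if "B \<in> sigma_sets UNIV (range (\<lambda>(a, b). box a b :: 'a set))" for B
    using that by (simp add: borel_eq_box)
  have int: "set_integrable lborel B f" if "B \<in> sets lborel" for B
    using f(1) that unfolding set_integrable_def by (rule integrable_mult_indicator[rotated])
  have stable: "Int_stable (range (\<lambda>(a, b). box a b :: 'a set))"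
  proof (rule Int_stableI)
    fix A B :: "'a set" assume "A \<in> range (\<lambda>(a, b). box a b)" "B \<in> range (\<lambda>(a, b). box a b)"
    then obtain a b c d where AB: "A = box a b" "B = box c d" by auto
    obtain p q where "box a b \<inter> box c d = box p q" using box_Int_box_is_box by meson
    then show "A \<inter> B \<in> range (\<lambda>(a, b). box a b)" unfolding AB by (intro image_eqI[of _ _ "(p, q)"]) simp_all
  qed
  have closed: "range (\<lambda>(a, b). box a b :: 'a set) \<subseteq> Pow UNIV" by simp
  from stable closed A have "(LINT x:A|lborel. f x) = 0"
  proof (induction rule: sigma_sets_induct_disjoint)
    case (basic B)
    then show ?case using box0 by auto
  next
    case empty
    show ?case by (simp add: set_lebesgue_integral_def)
  next
    case (compl B)
    have "(LINT x:B \<union> (UNIV - B)|lborel. f x) = (LINT x:B|lborel. f x) + (LINT x:UNIV - B|lborel. f x)"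
      using sub[OF compl(1)] by (intro set_integral_Un int) auto
    then show ?case using compl(2) f(2) by (simp add: set_lebesgue_integral_def)
  next
    case (union B)
    then have B: "range B \<subseteq> sets lborel" using sub by blast
    have "(LINT x:(\<Union>i. B i)|lborel. f x) = (\<Sum>i. LINT x:B i|lborel. f x)"
      using B union(1) by (intro lebesgue_integral_countable_add int) (auto simp: disjoint_family_on_def)
    then show ?case using union(3) by simp
  qed
  then show "(LINT x:A|lborel. f x) = (LINT x:A|lborel. 0)"
    by (simp add: set_lebesgue_integral_def)
qed

text \<open>Testing with bumps and passing to the limit shows that \<open>h\<close> has vanishing integral over every box
inside \<open>\<Omega>\<close>; hence it vanishes almost everywhere in each such box, and countably many of them
cover \<open>\<Omega>\<close>.\<close>

lemma fundamental_lemma_of_variations: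
  fixes h :: "'a::euclidean_space \<Rightarrow> real"
  assumes op: "open \<Omega>" and h: "square_integrable h"
    and orth: "\<And>\<phi>. \<phi> \<in> test_functions \<Omega> \<Longrightarrow> (LINT x|lborel. h x * \<phi> x) = 0"
  shows "AE x in lborel. x \<in> \<Omega> \<longrightarrow> h x = 0"
proof -
  have hm: "h \<in> borel_measurable borel" using h by (simp add: square_integrable_def)
  have int: "set_integrable lborel (box a b) h" for a b
    unfolding set_integrable_def
  proof (rule Bochner_Integration.integrable_bound)
    show "integrable lborel (\<lambda>x. indicator (box a b) x + (norm (h x))\<^sup>2)"
      using h emeasure_bounded_finite[OF bounded_box, of a b]
      by (intro Bochner_Integration.integrable_add integrable_real_indicator)
        (simp_all add: square_integrable_def)
    \<comment> \<open>A square integrable function is integrable on sets of finite measure.\<close>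
    have "\<bar>t\<bar> \<le> 1 + t\<^sup>2" for t :: real
      using zero_le_power2[of "\<bar>t\<bar> - 1"] by (simp add: power2_eq_square algebra_simps)
    then show "AE x in lborel. norm (indicator (box a b) x *\<^sub>R h x)
        \<le> norm (indicator (box a b) x + (norm (h x))\<^sup>2)"
      by (intro AE_I2) (auto simp: indicator_def)
  qed (use hm in simp)
  have zero: "AE x in lborel. x \<in> box a b \<longrightarrow> h x = 0" if ab: "box a b \<subseteq> \<Omega>" for a b
  proof -
    have "AE x in lborel. indicator (box a b) x *\<^sub>R h x = 0"
    proof (rule AE_zero_if_box_integrals_zero)
      show "integrable lborel (\<lambda>x. indicator (box a b) x *\<^sub>R h x)"
        using int by (simp add: set_integrable_def)
      show "(LINT x|lborel. indicator (box a b) x *\<^sub>R h x) = 0"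
        using set_integral_box_zero[OF hm int ab orth] by (simp add: set_lebesgue_integral_def)
      fix c d :: 'a
      obtain a' b' where *: "box c d \<inter> box a b = box a' b'"
        using box_Int_box_is_box by meson
      have "(LINT x:box a' b'|lborel. h x) = 0"
        using ab * by (intro set_integral_box_zero[OF hm int _ orth]) auto
      moreover have "indicator (box c d) x *\<^sub>R (indicator (box a b) x *\<^sub>R h x)
          = indicator (box a' b') x *\<^sub>R h x" for x
        unfolding *[symmetric] by (simp add: indicator_def)
      ultimately show "(LINT x:box c d|lborel. indicator (box a b) x *\<^sub>R h x) = 0"
        by (simp only: set_lebesgue_integral_def)
    qed
    then show ?thesis by eventually_elim (auto simp: indicator_def)
  qed
  obtain D where D: "countable D" "D \<subseteq> Pow \<Omega>" "\<And>X. X \<in> D \<Longrightarrow> \<exists>a b. X = box a b" "\<Union>D = \<Omega>"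
    using open_countable_Union_open_box[OF op] by metis
  have "AE x in lborel. \<forall>X\<in>D. x \<in> X \<longrightarrow> h x = 0"
    unfolding AE_ball_countable[OF D(1)] using D(2,3) zero by (metis Pow_iff subsetD)
  then show ?thesis by eventually_elim (use D(4) in auto)
qed

section \<open>Integration by parts for test functions\<close>

text \<open>Translation invariance of Lebesgue measure makes the integral of every difference quotient of \<open>F\<close>
vanish. The quotients converge to the derivative, and by the mean value theorem they are bounded
uniformly, with supports in a common ball, so dominated convergence applies.\<close>

lemma integral_directional_derivative_zero:
  fixes F :: "'a::euclidean_space \<Rightarrow> real"
  assumes F: "Ck 1 F" and K: "compact K" "\<And>x. x \<notin> K \<Longrightarrow> F x = 0" and i: "i \<in> Basis"
  shows "(LINT x|lborel. frechet_derivative F (at x) i) = 0"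
proof -
  let ?D = "\<lambda>x. frechet_derivative F (at x) i"
  have diff: "F differentiable (at x)" for x using F by simp
  have contD: "continuous_on UNIV ?D" using F i by simp
  have contF: "continuous_on UNIV F" using F by (rule Ck_imp_continuous)
  obtain R where R: "\<And>x. x \<in> K \<Longrightarrow> norm x \<le> R"
    using compact_imp_bounded[OF K(1)] by (auto simp: bounded_iff)
  define B where "B = cball (0::'a) (R + 1)"
  have "compact (?D ` cball 0 (R + 2))"
    by (intro compact_continuous_image continuous_on_subset[OF contD]) auto
  then obtain M where "\<forall>x\<in>cball 0 (R + 2). \<bar>?D x\<bar> \<le> M"
    using compact_imp_bounded[of "?D ` cball 0 (R + 2)"] unfolding bounded_iff by auto
  then have M: "\<bar>?D x\<bar> \<le> M" if "norm x \<le> R + 2" for x using that by simp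
  define t where "t n = inverse (real (Suc n))" for n
  have t: "0 < t n" "t n \<le> 1" for n by (auto simp: t_def field_simps)
  have t0: "t \<longlonglongrightarrow> 0" unfolding t_def by (rule LIMSEQ_inverse_real_of_nat)
  define q where "q n x = (F (x + t n *\<^sub>R i) - F x) / t n" for n x
  have line: "((\<lambda>s. F (x + s *\<^sub>R i)) has_real_derivative ?D (x + s *\<^sub>R i)) (at s)" for x s
  proof -
    have "((\<lambda>s. F (x + s *\<^sub>R i)) has_derivative (\<lambda>r. frechet_derivative F (at (x + s *\<^sub>R i)) (r *\<^sub>R i))) (at s)"
      by (rule has_derivative_compose[of "\<lambda>s. x + s *\<^sub>R i" "\<lambda>r. r *\<^sub>R i" _ _ F])
         (auto intro!: derivative_eq_intros has_frechet_derivative diff)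
    moreover have "frechet_derivative F (at (x + s *\<^sub>R i)) (r *\<^sub>R i) = ?D (x + s *\<^sub>R i) * r" for r
      using linear_frechet_derivative[OF diff] by (simp add: linear_cmul)
    ultimately show ?thesis by (simp add: has_field_derivative_def)
  qed
  have lim: "(\<lambda>n. q n x) \<longlonglongrightarrow> ?D x" for x
  proof -
    have "((\<lambda>h. (F (x + h *\<^sub>R i) - F x) / h) \<longlongrightarrow> ?D x) (at 0)"
      using line[of x 0] by (simp add: DERIV_def)
    moreover have "filterlim t (at 0) sequentially"
      using t0 t(1) by (auto simp: filterlim_at intro!: always_eventually less_imp_neq[THEN not_sym])
    ultimately show ?thesis unfolding q_def by (rule filterlim_compose)
  qed
  have bound: "\<bar>q n x\<bar> \<le> M * indicator B x" for n x
  proof (cases "x \<in> B")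
    case True
    obtain z where z: "0 < z" "z < t n" "F (x + t n *\<^sub>R i) - F (x + 0 *\<^sub>R i) = (t n - 0) * ?D (x + z *\<^sub>R i)"
      using MVT2[OF t(1), where f = "\<lambda>s. F (x + s *\<^sub>R i)" and f' = "\<lambda>s. ?D (x + s *\<^sub>R i)"] line by blast
    have "norm (x + z *\<^sub>R i) \<le> norm x + z"
      using norm_triangle_ineq[of x "z *\<^sub>R i"] i z(1) by simp
    also have "\<dots> \<le> R + 2" using True z t(2)[of n] by (simp add: B_def)
    finally have "\<bar>?D (x + z *\<^sub>R i)\<bar> \<le> M" by (rule M)
    moreover have "q n x = ?D (x + z *\<^sub>R i)" using z(3) t(1)[of n] by (simp add: q_def)
    ultimately show ?thesis using True by simp
  next
    case False
    then have n: "norm x > R + 1" by (simp add: B_def)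
    have "norm x \<le> norm (x + t n *\<^sub>R i) + t n"
      using norm_triangle_ineq4[of "x + t n *\<^sub>R i" "t n *\<^sub>R i"] i t(1)[of n] by simp
    then have "R < norm (x + t n *\<^sub>R i)" using n t(2)[of n] by linarith
    then have "F (x + t n *\<^sub>R i) = 0" "F x = 0" using K(2) R n by fastforce+
    then show ?thesis using False by (simp add: q_def)
  qed
  have contq: "continuous_on UNIV (q n)" for n
    unfolding q_def using t(1)[of n]
    by (intro continuous_intros continuous_on_compose2[OF contF]) auto
  have intF: "integrable lborel F" by (rule continuous_compact_support_integrable[OF contF K])
  have int_q: "(LINT x|lborel. q n x) = 0" for n
  proof -
    have "(LINT x|lborel. F x) = (LINT x|distr lborel borel ((+) (t n *\<^sub>R i)). F x)"
      by (simp add: lborel_distr_plus)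
    also have "\<dots> = (LINT x|lborel. F (t n *\<^sub>R i + x))"
      using borel_measurable_continuous_onI[OF contF] by (intro integral_distr) auto
    finally have e: "(LINT x|lborel. F (x + t n *\<^sub>R i)) = (LINT x|lborel. F x)"
      by (simp add: add.commute)
    have "integrable (distr lborel borel ((+) (t n *\<^sub>R i))) F"
      using intF by (simp add: lborel_distr_plus)
    then have "integrable lborel (\<lambda>x. F (t n *\<^sub>R i + x))"
      by (rule integrable_distr[rotated]) simp
    then have "integrable lborel (\<lambda>x. F (x + t n *\<^sub>R i))" by (simp add: add.commute)
    then show ?thesis using intF e by (simp add: q_def Bochner_Integration.integral_diff)
  qed
  have "(\<lambda>n. LINT x|lborel. q n x) \<longlonglongrightarrow> (LINT x|lborel. ?D x)"
  proof (rule integral_dominated_convergence[where w = "\<lambda>x. M * indicator B x"])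
    show "integrable lborel (\<lambda>x. M * indicator B x)"
      using emeasure_bounded_finite[OF bounded_cball, of "0::'a" "R + 1"]
      by (intro integrable_mult_right integrable_real_indicator) (simp_all add: B_def)
    show "?D \<in> borel_measurable lborel" using borel_measurable_continuous_onI[OF contD] by simp
    show "q n \<in> borel_measurable lborel" for n
      using borel_measurable_continuous_onI[OF contq] by simp
  qed (use lim bound in auto)
  then show ?thesis using int_q by (simp add: LIMSEQ_const_iff)
qed

section \<open>The weak gradient\<close>

lemma l2_class_eq_iff:
  assumes "square_integrable f" "square_integrable g"
  shows "l2_class f = l2_class g \<longleftrightarrow> (AE x in lborel. f x = g x)"
  using assms Quotient3_rel[OF Quotient3_l2, of f g] by simp

lemma l2_repr: obtains f where "square_integrable f" "u = l2_class f"
  by (induction u rule: l2.abs_induct) auto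

lemma l2_class_add:
  "square_integrable f \<Longrightarrow> square_integrable g \<Longrightarrow> l2_class f + l2_class g = l2_class (\<lambda>x. f x + g x)"
  by (simp add: plus_l2.abs_eq)

lemma l2_class_scaleR:
  "square_integrable f \<Longrightarrow> c *\<^sub>R l2_class f = l2_class (\<lambda>x. c *\<^sub>R f x)"
  by (simp add: scaleR_l2.abs_eq)

lemma inner_l2_class:
  "square_integrable f \<Longrightarrow> square_integrable g \<Longrightarrow> l2_class f \<bullet> l2_class g = (LINT x|lborel. f x \<bullet> g x)"
  by (simp add: inner_l2.abs_eq)

lemma ae_eq_on_l2_class:
  "square_integrable f \<Longrightarrow> ae_eq_on S (l2_class f) g \<longleftrightarrow> (AE x in lborel. x \<in> S \<longrightarrow> f x = g x)"
  by (simp add: ae_eq_on.abs_eq)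

lemma ae_eq_on_add:
  assumes "ae_eq_on S u f" "ae_eq_on S v g"
  shows "ae_eq_on S (u + v) (\<lambda>x. f x + g x)"
proof -
  obtain u' v' where *: "square_integrable u'" "u = l2_class u'" "square_integrable v'" "v = l2_class v'"
    by (metis l2_repr)
  show ?thesis
    using assms unfolding * l2_class_add[OF *(1,3)]
      ae_eq_on_l2_class[OF *(1)] ae_eq_on_l2_class[OF *(3)]
      ae_eq_on_l2_class[OF square_integrable_add[OF *(1,3)]]
    by eventually_elim simp
qed

lemma ae_eq_on_scaleR:
  assumes "ae_eq_on S u f"
  shows "ae_eq_on S (c *\<^sub>R u) (\<lambda>x. c *\<^sub>R f x)"
proof -
  obtain u' where *: "square_integrable u'" "u = l2_class u'" by (metis l2_repr)
  show ?thesis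
    using assms unfolding * l2_class_scaleR[OF *(1)]
      ae_eq_on_l2_class[OF *(1)] ae_eq_on_l2_class[OF square_integrable_scaleR[OF *(1)]]
    by eventually_elim simp
qed

lemma subspace_L2: "subspace (L2 \<Omega>)"
proof (rule subspaceI)
  show "0 \<in> L2 \<Omega>"
    by (simp add: L2_def zero_l2.abs_eq ae_eq_on_l2_class square_integrable_zero)
qed (use ae_eq_on_add[of "- \<Omega>" _ "\<lambda>x. 0" _ "\<lambda>x. 0"] ae_eq_on_scaleR[of "- \<Omega>" _ "\<lambda>x. 0"]
      in \<open>auto simp: L2_def\<close>)

lemma weak_gradient_0: "weak_gradient \<Omega> 0 0"
  by (simp add: weak_gradient_def subspace_0[OF subspace_L2])

lemma weak_gradient_add:
  assumes "weak_gradient \<Omega> u g" "weak_gradient \<Omega> v h"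
  shows "weak_gradient \<Omega> (u + v) (g + h)"
  using assms by (auto simp: weak_gradient_def inner_add_left intro: subspace_add[OF subspace_L2])

lemma weak_gradient_scaleR:
  assumes "weak_gradient \<Omega> u g"
  shows "weak_gradient \<Omega> (c *\<^sub>R u) (c *\<^sub>R g)"
  using assms by (auto simp: weak_gradient_def intro: subspace_scale[OF subspace_L2])

text \<open>Without uniqueness \<open>grad\<close>, a definite description, would carry no information; with it the
gradient is linear on \<open>H1 \<Omega>\<close> and the energy is a bilinear form.\<close>

lemma weak_gradient_unique_0:
  fixes g :: "('a::euclidean_space, 'a) l2"
  assumes op: "open \<Omega>" and g: "weak_gradient \<Omega> 0 g"
  shows "g = 0"
proof -
  obtain f where f: "square_integrable f" "g = l2_class f" by (rule l2_repr)
  have comp: "square_integrable (\<lambda>x. f x \<bullet> i)" if "i \<in> Basis" for i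
    unfolding square_integrable_def
  proof
    show m: "(\<lambda>x. f x \<bullet> i) \<in> borel_measurable lborel"
      using f(1) unfolding square_integrable_def by (intro borel_measurable_inner) auto
    show "integrable lborel (\<lambda>x. (norm (f x \<bullet> i))\<^sup>2)"
    proof (rule Bochner_Integration.integrable_bound)
      show "integrable lborel (\<lambda>x. (norm (f x))\<^sup>2)" using f by (simp add: square_integrable_def)
      show "AE x in lborel. norm ((norm (f x \<bullet> i))\<^sup>2) \<le> norm ((norm (f x))\<^sup>2)"
        using Basis_le_norm[OF that] by (intro AE_I2) (simp add: abs_le_square_iff[symmetric])
    qed (use m in measurable)
  qed
  have "AE x in lborel. x \<in> \<Omega> \<longrightarrow> f x \<bullet> i = 0" if i: "i \<in> Basis" for i
  proof (rule fundamental_lemma_of_variations[OF op comp[OF i]])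
    fix \<phi> assume \<phi>: "\<phi> \<in> test_functions \<Omega>"
    have "g \<bullet> l2_class (\<lambda>x. \<phi> x *\<^sub>R i) = 0"
      using g \<phi> i by (auto simp: weak_gradient_def)
    then have "(LINT x|lborel. f x \<bullet> (\<phi> x *\<^sub>R i)) = 0"
      using f \<phi> by (simp add: inner_l2_class square_integrable_scaleR_vector square_integrable_test_function)
    then show "(LINT x|lborel. f x \<bullet> i * \<phi> x) = 0" by (simp add: mult.commute)
  qed
  then have "AE x in lborel. \<forall>i\<in>Basis. x \<in> \<Omega> \<longrightarrow> f x \<bullet> i = 0"
    by (subst AE_ball_countable) (auto simp: countable_finite)
  moreover have "AE x in lborel. x \<in> - \<Omega> \<longrightarrow> f x = 0"
    using g f by (simp add: weak_gradient_def L2_def ae_eq_on_l2_class)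
  ultimately have "AE x in lborel. f x = 0"
    by eventually_elim (auto intro: euclidean_eqI)
  then show ?thesis
    using f by (simp add: zero_l2.abs_eq l2_class_eq_iff square_integrable_zero)
qed

lemma weak_gradient_unique:
  assumes "open \<Omega>" "weak_gradient \<Omega> u g" "weak_gradient \<Omega> u h"
  shows "g = h"
  using weak_gradient_unique_0[OF assms(1), of "g - h"]
    weak_gradient_add[OF assms(2) weak_gradient_scaleR[OF assms(3), of "- 1"]] by simp

lemma grad_eq: "open \<Omega> \<Longrightarrow> weak_gradient \<Omega> u g \<Longrightarrow> grad \<Omega> u = g"
  unfolding grad_def using weak_gradient_unique by (intro the_equality) auto

lemma weak_gradient_grad: "open \<Omega> \<Longrightarrow> u \<in> H1 \<Omega> \<Longrightarrow> weak_gradient \<Omega> u (grad \<Omega> u)"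
  using grad_eq by (auto simp: H1_def)

lemma subspace_H1: "subspace (H1 \<Omega>)"
  by (rule subspaceI) (use weak_gradient_0 weak_gradient_add weak_gradient_scaleR in \<open>auto simp: H1_def, blast+\<close>)

lemma grad_add:
  "open \<Omega> \<Longrightarrow> u \<in> H1 \<Omega> \<Longrightarrow> v \<in> H1 \<Omega> \<Longrightarrow> grad \<Omega> (u + v) = grad \<Omega> u + grad \<Omega> v"
  by (intro grad_eq weak_gradient_add weak_gradient_grad)

lemma grad_scaleR: "open \<Omega> \<Longrightarrow> u \<in> H1 \<Omega> \<Longrightarrow> grad \<Omega> (c *\<^sub>R u) = c *\<^sub>R grad \<Omega> u"
  by (intro grad_eq weak_gradient_scaleR weak_gradient_grad)

text \<open>Integration by parts: the product of two test functions has compact support, so the integral of each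
of its partial derivatives vanishes, and the product rule shows that the classical gradient is a weak
gradient. Membership in \<open>H1 \<Omega>\<close> is what lets the triangle inequality of \<open>H1_norm\<close> be
applied to the differences \<open>u - l2_class \<phi>\<close> that define \<open>H10 \<Omega>\<close>.\<close>

lemma test_function_in_H1:
  fixes \<phi> :: "'a::euclidean_space \<Rightarrow> real"
  assumes \<phi>: "\<phi> \<in> test_functions \<Omega>"
  shows "l2_class \<phi> \<in> H1 \<Omega>"
proof -
  let ?K = "closure (support_on UNIV \<phi>)"
  define g where "g x = (\<Sum>i\<in>Basis. frechet_derivative \<phi> (at x) i *\<^sub>R i)" for x
  have gi: "g x \<bullet> i = frechet_derivative \<phi> (at x) i" if "i \<in> Basis" for x i
    using that by (simp add: g_def)
  have "square_integrable (\<lambda>x. \<Sum>i\<in>A. frechet_derivative \<phi> (at x) i *\<^sub>R i)"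
    if "finite A" "A \<subseteq> Basis" for A
    using that
    by (induction A rule: finite_induct)
      (auto intro!: square_integrable_add square_integrable_scaleR_vector
        square_integrable_deriv_test_function[OF \<phi>] simp: square_integrable_zero)
  then have g2: "square_integrable g" unfolding g_def[abs_def] by auto
  note \<phi>2 = square_integrable_test_function[OF \<phi>]
  have out: "\<phi> x = 0" "g x = 0" if "x \<in> - \<Omega>" for x
  proof -
    have "x \<notin> ?K" using that test_functionD(5)[OF \<phi>] by auto
    then show "\<phi> x = 0" "g x = 0" using outside_support[of x \<phi>] by (auto simp: g_def)
  qed
  have "weak_gradient \<Omega> (l2_class \<phi>) (l2_class g)"
    unfolding weak_gradient_def
  proof (intro conjI ballI)
    show "l2_class \<phi> \<in> L2 \<Omega>" "l2_class g \<in> L2 \<Omega>"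
      using out by (auto simp: L2_def ae_eq_on_l2_class \<phi>2 g2)
    fix \<psi> and i :: 'a assume \<psi>: "\<psi> \<in> test_functions \<Omega>" and i: "i \<in> Basis"
    let ?F = "\<lambda>x. \<phi> x * \<psi> x"
    have D: "frechet_derivative ?F (at x) i
        = \<phi> x * frechet_derivative \<psi> (at x) i + frechet_derivative \<phi> (at x) i * \<psi> x" for x
    proof -
      have "(?F has_derivative (\<lambda>i. \<phi> x * frechet_derivative \<psi> (at x) i
          + frechet_derivative \<phi> (at x) i * \<psi> x)) (at x)"
        by (intro has_derivative_mult has_frechet_derivative test_functionD(3)[OF \<phi>]
            test_functionD(3)[OF \<psi>])
      then show ?thesis by (simp add: frechet_derivative_eq)
    qed
    have "(LINT x|lborel. frechet_derivative ?F (at x) i) = 0"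
      by (rule integral_directional_derivative_zero[OF _ test_functionD(4)[OF \<phi>] _ i])
         (auto intro!: Ck_mult test_functionD(1)[OF \<phi>] test_functionD(1)[OF \<psi>] simp: outside_support(1)
           simp del: Ck.simps One_nat_def)
    moreover have "l2_class \<phi> \<bullet> l2_class (\<lambda>x. frechet_derivative \<psi> (at x) i)
        = (LINT x|lborel. \<phi> x * frechet_derivative \<psi> (at x) i)"
      by (simp add: inner_l2_class \<phi>2 square_integrable_deriv_test_function[OF \<psi> i])
    moreover have "l2_class g \<bullet> l2_class (\<lambda>x. \<psi> x *\<^sub>R i)
        = (LINT x|lborel. frechet_derivative \<phi> (at x) i * \<psi> x)"
      by (simp add: inner_l2_class g2 square_integrable_scaleR_vector
          square_integrable_test_function[OF \<psi>] gi[OF i] mult.commute)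
    moreover have "integrable lborel (\<lambda>x. \<phi> x * frechet_derivative \<psi> (at x) i)"
      using square_integrable_inner[OF \<phi>2 square_integrable_deriv_test_function[OF \<psi> i]] by simp
    moreover have "integrable lborel (\<lambda>x. frechet_derivative \<phi> (at x) i * \<psi> x)"
      using square_integrable_inner[OF square_integrable_deriv_test_function[OF \<phi> i]
          square_integrable_test_function[OF \<psi>]] by simp
    ultimately show "l2_class \<phi> \<bullet> l2_class (\<lambda>x. frechet_derivative \<psi> (at x) i)
        = - (l2_class g \<bullet> l2_class (\<lambda>x. \<psi> x *\<^sub>R i))"
      by (simp add: D Bochner_Integration.integral_add)
  qed
  then show ?thesis by (auto simp: H1_def)
qed

section \<open>Linearity of the energy space and of the finite element space\<close>

lemma test_function_zero: "(\<lambda>x. 0) \<in> test_functions \<Omega>"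
  by (rule test_functionI[OF Ck_const compact_empty]) auto

lemma test_function_add:
  assumes "\<phi> \<in> test_functions \<Omega>" "\<psi> \<in> test_functions \<Omega>"
  shows "(\<lambda>x. \<phi> x + \<psi> x) \<in> test_functions \<Omega>"
proof (rule test_functionI)
  show "compact (closure (support_on UNIV \<phi>) \<union> closure (support_on UNIV \<psi>))"
    by (intro compact_Un test_functionD(4)[OF assms(1)] test_functionD(4)[OF assms(2)])
qed (use test_functionD(5)[OF assms(1)] test_functionD(5)[OF assms(2)] in
    \<open>auto intro!: Ck_add test_functionD(1)[OF assms(1)] test_functionD(1)[OF assms(2)]
      simp: outside_support(1)\<close>)

lemma test_function_scale:
  assumes "\<phi> \<in> test_functions \<Omega>"
  shows "(\<lambda>x. c * \<phi> x) \<in> test_functions \<Omega>"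
  by (rule test_functionI[OF Ck_scale[OF test_functionD(1)[OF assms]] test_functionD(4,5)[OF assms]])
     (simp add: outside_support(1))

lemma H1_norm_add:
  assumes "open \<Omega>" "u \<in> H1 \<Omega>" "v \<in> H1 \<Omega>"
  shows "H1_norm \<Omega> (u + v) \<le> H1_norm \<Omega> u + H1_norm \<Omega> v"
proof -
  have "H1_norm \<Omega> (u + v) \<le> sqrt ((norm u + norm v)\<^sup>2 + (norm (grad \<Omega> u) + norm (grad \<Omega> v))\<^sup>2)"
    unfolding H1_norm_def grad_add[OF assms]
    by (intro real_sqrt_le_mono add_mono power_mono norm_triangle_ineq norm_ge_zero)
  also have "\<dots> \<le> H1_norm \<Omega> u + H1_norm \<Omega> v"
    unfolding H1_norm_def by (rule real_sqrt_sum_squares_triangle_ineq)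
  finally show ?thesis .
qed

lemma H1_norm_scaleR:
  assumes "open \<Omega>" "u \<in> H1 \<Omega>"
  shows "H1_norm \<Omega> (c *\<^sub>R u) = \<bar>c\<bar> * H1_norm \<Omega> u"
  by (simp add: H1_norm_def grad_scaleR[OF assms] power_mult_distrib distrib_left[symmetric]
      real_sqrt_mult)

lemma subspace_H10:
  assumes op: "open \<Omega>"
  shows "subspace (H10 \<Omega>)"
proof (rule subspaceI)
  have "H1_norm \<Omega> (0 - l2_class (\<lambda>x. 0)) = 0"
    using grad_eq[OF op weak_gradient_0] by (simp add: H1_norm_def zero_l2.abs_eq[symmetric])
  then show "0 \<in> H10 \<Omega>"
    using subspace_0[OF subspace_H1] test_function_zero unfolding H10_def by force
next
  fix u v assume u: "u \<in> H10 \<Omega>" and v: "v \<in> H10 \<Omega>"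
  have "\<exists>\<phi>\<in>test_functions \<Omega>. H1_norm \<Omega> (u + v - l2_class \<phi>) < e" if "e > 0" for e
  proof -
    have e: "e / 2 > 0" using that by simp
    obtain \<phi> where \<phi>: "\<phi> \<in> test_functions \<Omega>" "H1_norm \<Omega> (u - l2_class \<phi>) < e / 2"
      using u e unfolding H10_def by blast
    obtain \<psi> where \<psi>: "\<psi> \<in> test_functions \<Omega>" "H1_norm \<Omega> (v - l2_class \<psi>) < e / 2"
      using v e unfolding H10_def by blast
    have "u + v - l2_class (\<lambda>x. \<phi> x + \<psi> x) = (u - l2_class \<phi>) + (v - l2_class \<psi>)"
      using \<phi> \<psi> by (simp add: l2_class_add[symmetric] square_integrable_test_function)
    moreover have "H1_norm \<Omega> ((u - l2_class \<phi>) + (v - l2_class \<psi>)) < e"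
      using H1_norm_add[OF op, of "u - l2_class \<phi>" "v - l2_class \<psi>"] \<phi> \<psi> u v
      by (simp add: H10_def subspace_diff[OF subspace_H1] test_function_in_H1)
    ultimately show ?thesis using test_function_add[OF \<phi>(1) \<psi>(1)] by metis
  qed
  then show "u + v \<in> H10 \<Omega>"
    using u v subspace_add[OF subspace_H1] by (auto simp: H10_def)
next
  fix c u assume u: "u \<in> H10 \<Omega>"
  have "\<exists>\<phi>\<in>test_functions \<Omega>. H1_norm \<Omega> (c *\<^sub>R u - l2_class \<phi>) < e" if "e > 0" for e
  proof -
    have e: "e / (\<bar>c\<bar> + 1) > 0" using that by simp
    obtain \<phi> where \<phi>: "\<phi> \<in> test_functions \<Omega>" "H1_norm \<Omega> (u - l2_class \<phi>) < e / (\<bar>c\<bar> + 1)"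
      using u e unfolding H10_def by blast
    have "c *\<^sub>R u - l2_class (\<lambda>x. c * \<phi> x) = c *\<^sub>R (u - l2_class \<phi>)"
      using \<phi> l2_class_scaleR[of \<phi> c] by (simp add: square_integrable_test_function scaleR_diff_right)
    moreover have "H1_norm \<Omega> (c *\<^sub>R (u - l2_class \<phi>)) = \<bar>c\<bar> * H1_norm \<Omega> (u - l2_class \<phi>)"
      using u \<phi> by (intro H1_norm_scaleR op) (simp add: H10_def subspace_diff[OF subspace_H1] test_function_in_H1)
    moreover have "\<bar>c\<bar> * H1_norm \<Omega> (u - l2_class \<phi>) \<le> \<bar>c\<bar> * (e / (\<bar>c\<bar> + 1))"
      using \<phi>(2) by (intro mult_left_mono) auto
    moreover have "\<bar>c\<bar> * (e / (\<bar>c\<bar> + 1)) < e"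
      using that by (simp add: field_simps)
    ultimately show ?thesis
      using test_function_scale[OF \<phi>(1), of c] by (intro bexI[of _ "\<lambda>x. c * \<phi> x"]) auto
  qed
  then show "c *\<^sub>R u \<in> H10 \<Omega>"
    using u subspace_scale[OF subspace_H1] by (auto simp: H10_def)
qed

lemma polys_add:
  assumes "f \<in> polys p" "g \<in> polys p"
  shows "(\<lambda>x. f x + g x) \<in> polys p"
proof -
  obtain c d where "f = (\<lambda>x. \<Sum>\<alpha> | \<alpha> \<in> Basis \<rightarrow>\<^sub>E UNIV \<and> sum \<alpha> Basis \<le> p.
        c \<alpha> * (\<Prod>i\<in>Basis. (x \<bullet> i) ^ \<alpha> i))"
      "g = (\<lambda>x. \<Sum>\<alpha> | \<alpha> \<in> Basis \<rightarrow>\<^sub>E UNIV \<and> sum \<alpha> Basis \<le> p.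
        d \<alpha> * (\<Prod>i\<in>Basis. (x \<bullet> i) ^ \<alpha> i))"
    using assms unfolding polys_def by blast
  then show ?thesis
    unfolding polys_def
    by (auto intro!: exI[of _ "\<lambda>\<alpha>. c \<alpha> + d \<alpha>"] simp: distrib_right sum.distrib)
qed

lemma polys_scale:
  assumes "f \<in> polys p"
  shows "(\<lambda>x. r * f x) \<in> polys p"
proof -
  obtain c where "f = (\<lambda>x. \<Sum>\<alpha> | \<alpha> \<in> Basis \<rightarrow>\<^sub>E UNIV \<and> sum \<alpha> Basis \<le> p.
        c \<alpha> * (\<Prod>i\<in>Basis. (x \<bullet> i) ^ \<alpha> i))"
    using assms unfolding polys_def by blast
  then show ?thesis
    unfolding polys_def
    by (auto intro!: exI[of _ "\<lambda>\<alpha>. r * c \<alpha>"] simp: sum_distrib_left mult.assoc)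
qed

lemma polys_zero: "(\<lambda>x. 0) \<in> polys p"
  unfolding polys_def by (auto intro!: exI[of _ "\<lambda>\<alpha>. 0"])

lemma subspace_fe_space:
  assumes "open \<Omega>"
  shows "subspace (fe_space \<Omega> \<T> p)"
proof (rule subspaceI)
  have "ae_eq_on K 0 (\<lambda>x. 0)" for K
    by (simp add: zero_l2.abs_eq ae_eq_on_l2_class square_integrable_zero)
  then show "0 \<in> fe_space \<Omega> \<T> p"
    using subspace_0[OF subspace_H10[OF assms]] polys_zero by (auto simp: fe_space_def)
next
  fix u v assume u: "u \<in> fe_space \<Omega> \<T> p" and v: "v \<in> fe_space \<Omega> \<T> p"
  have "\<exists>q\<in>polys p. ae_eq_on K (u + v) q" if "K \<in> \<T>" for K
  proof -
    obtain f g where "f \<in> polys p" "ae_eq_on K u f" "g \<in> polys p" "ae_eq_on K v g"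
      using u v \<open>K \<in> \<T>\<close> unfolding fe_space_def by blast
    then show ?thesis using polys_add ae_eq_on_add by meson
  qed
  then show "u + v \<in> fe_space \<Omega> \<T> p"
    using u v subspace_add[OF subspace_H10[OF assms]] by (simp add: fe_space_def)
next
  fix c u assume u: "u \<in> fe_space \<Omega> \<T> p"
  have "\<exists>q\<in>polys p. ae_eq_on K (c *\<^sub>R u) q" if "K \<in> \<T>" for K
  proof -
    obtain f where f: "f \<in> polys p" "ae_eq_on K u f"
      using u \<open>K \<in> \<T>\<close> unfolding fe_space_def by blast
    show ?thesis using polys_scale[OF f(1), of c] ae_eq_on_scaleR[OF f(2), of c] by auto
  qed
  then show "c *\<^sub>R u \<in> fe_space \<Omega> \<T> p"
    using u subspace_scale[OF subspace_H10[OF assms]] by (simp add: fe_space_def)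
qed

section \<open>Orthonormal families\<close>

definition orthonormal_on :: "'i set \<Rightarrow> ('i \<Rightarrow> 'v::real_inner) \<Rightarrow> bool" where
  "orthonormal_on I e \<longleftrightarrow> (\<forall>i\<in>I. \<forall>j\<in>I. e i \<bullet> e j = (if i = j then 1 else 0))"

lemma orthonormal_on_subset: "orthonormal_on I e \<Longrightarrow> J \<subseteq> I \<Longrightarrow> orthonormal_on J e"
  unfolding orthonormal_on_def by (meson subsetD)

lemma orthonormal_inner_sum:
  assumes "finite I" "orthonormal_on I e" "j \<in> I"
  shows "(\<Sum>i\<in>I. c i *\<^sub>R e i) \<bullet> e j = c j"
proof -
  have "(\<Sum>i\<in>I. c i *\<^sub>R e i) \<bullet> e j = (\<Sum>i\<in>I. c i * (if i = j then 1 else 0))"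
    unfolding inner_sum_left by (rule sum.cong) (use assms in \<open>auto simp: orthonormal_on_def\<close>)
  then show ?thesis using assms by (simp add: if_distrib sum.delta cong: if_cong)
qed

lemma orthonormal_norm_sum:
  assumes "finite I" "orthonormal_on I e"
  shows "norm (\<Sum>i\<in>I. c i *\<^sub>R e i) = L2_set c I"
proof -
  have "(\<Sum>i\<in>I. c i *\<^sub>R e i) \<bullet> (\<Sum>i\<in>I. c i *\<^sub>R e i) = (\<Sum>j\<in>I. (c j)\<^sup>2)"
    by (subst inner_sum_right) (simp add: orthonormal_inner_sum[OF assms] power2_eq_square)
  then show ?thesis by (simp add: norm_eq_sqrt_inner L2_set_def)
qed

lemma orthonormal_expansion:
  assumes "finite I" "orthonormal_on I e" "v \<in> span (e ` I)"
  shows "v = (\<Sum>i\<in>I. (v \<bullet> e i) *\<^sub>R e i)"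
  using assms(3)
proof (induction rule: span_induct)
  case base
  let ?S = "{v. v = (\<Sum>i\<in>I. (v \<bullet> e i) *\<^sub>R e i)}"
  have "x + y \<in> ?S" if "x \<in> ?S" "y \<in> ?S" for x y
  proof -
    have "x + y = (\<Sum>i\<in>I. (x \<bullet> e i) *\<^sub>R e i) + (\<Sum>i\<in>I. (y \<bullet> e i) *\<^sub>R e i)"
      using that by auto
    then show ?thesis
      unfolding mem_Collect_eq inner_add_left scaleR_add_left sum.distrib .
  qed
  moreover have "c *\<^sub>R x \<in> ?S" if "x \<in> ?S" for c x
  proof -
    have "c *\<^sub>R x = c *\<^sub>R (\<Sum>i\<in>I. (x \<bullet> e i) *\<^sub>R e i)" using that by auto
    also have "\<dots> = (\<Sum>i\<in>I. ((c *\<^sub>R x) \<bullet> e i) *\<^sub>R e i)" by (simp add: scaleR_sum_right)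
    finally show ?thesis by (rule CollectI)
  qed
  moreover have "0 \<in> ?S" by simp
  ultimately show ?case unfolding subspace_def by blast
next
  case (step x)
  then obtain j where j: "j \<in> I" "x = e j" by auto
  have "(\<Sum>i\<in>I. (e j \<bullet> e i) *\<^sub>R e i) = (\<Sum>i\<in>I. if i = j then e j else 0)"
    using assms(2) j(1) by (intro sum.cong) (auto simp: orthonormal_on_def)
  then show ?case using j assms(1) by (simp add: sum.delta)
qed

lemma L2_set_scale_abs: "0 \<le> c \<Longrightarrow> L2_set (\<lambda>i. c * \<bar>f i\<bar>) A = c * L2_set f A"
  by (subst L2_set_right_distrib[symmetric]) (simp_all add: L2_set_def)

lemma bessel_inequality:
  assumes "finite I" "orthonormal_on I e"
  shows "L2_set (\<lambda>i. x \<bullet> e i) I \<le> norm x"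
proof -
  let ?w = "\<Sum>i\<in>I. (x \<bullet> e i) *\<^sub>R e i"
  have "x \<bullet> ?w = (\<Sum>i\<in>I. (x \<bullet> e i)\<^sup>2)" by (simp add: inner_sum_right power2_eq_square)
  also have "\<dots> = (norm ?w)\<^sup>2"
    by (simp add: orthonormal_norm_sum[OF assms] L2_set_def sum_nonneg)
  finally have *: "(norm ?w)\<^sup>2 = x \<bullet> ?w" by simp
  also have "\<dots> \<le> norm x * norm ?w" by (rule norm_cauchy_schwarz)
  finally have "norm ?w \<le> norm x"
    by (cases "norm ?w = 0") (auto simp: power2_eq_square)
  then show ?thesis by (simp add: orthonormal_norm_sum[OF assms])
qed

lemma orthonormal_independent:
  assumes "finite I" "orthonormal_on I e"
  shows "inj_on e I" "independent (e ` I)"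
proof -
  show inj: "inj_on e I"
    using assms(2) by (auto simp: inj_on_def orthonormal_on_def) (metis zero_neq_one)
  show "independent (e ` I)"
  proof (rule independent_if_scalars_zero)
    fix f x assume f: "(\<Sum>x\<in>e ` I. f x *\<^sub>R x) = 0" and "x \<in> e ` I"
    then obtain j where j: "j \<in> I" "x = e j" by auto
    have "(\<Sum>i\<in>I. f (e i) *\<^sub>R e i) \<bullet> e j = 0" using f by (simp add: sum.reindex[OF inj])
    then show "f x = 0" using orthonormal_inner_sum[OF assms j(1)] j(2) by simp
  qed (use assms(1) in simp)
qed

text \<open>The positivity of \<open>dim V\<close> guarantees that \<open>V\<close> is finite-dimensional, since \<open>dim\<close> is \<open>0\<close> for a space
with an infinite basis. A vector outside the span could then be added to the family, giving more
independent vectors than the dimension allows.\<close>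

lemma orthonormal_spans:
  assumes I: "finite I" "orthonormal_on I e" "e ` I \<subseteq> V" and dim: "card I = dim V" "0 < dim V"
  shows "V \<subseteq> span (e ` I)"
proof
  fix v assume v: "v \<in> V"
  show "v \<in> span (e ` I)"
  proof (rule ccontr)
    assume notin: "v \<notin> span (e ` I)"
    obtain B where B: "B \<subseteq> V" "independent B" "V \<subseteq> span B" "card B = dim V"
      by (rule basis_exists)
    have "finite B" using B(4) dim(2) by (intro card_ge_0_finite) simp
    moreover have "independent (insert v (e ` I))"
      by (rule independent_insertI[OF notin orthonormal_independent(2)[OF I(1,2)]])
    moreover have "insert v (e ` I) \<subseteq> span B"
      by (intro insert_subsetI subsetD[OF B(3) v] order_trans[OF I(3) B(3)])
    ultimately have "card (insert v (e ` I)) \<le> card B"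
      by (rule independent_span_bound[THEN conjunct2])
    moreover have "v \<notin> e ` I" using notin span_base[of v "e ` I"] by auto
    then have "card (insert v (e ` I)) = Suc (card I)"
      using I(1) by (simp add: card_image[OF orthonormal_independent(1)[OF I(1,2)]])
    ultimately show False using B(4) dim(1) by linarith
  qed
qed

lemma inner_form_proj_span:
  assumes "finite I" "orthonormal_on I e"
  shows "form_proj inner (span (e ` I)) w = (\<Sum>i\<in>I. (w \<bullet> e i) *\<^sub>R e i)"
  unfolding form_proj_def
proof (rule the_equality)
  let ?s = "\<Sum>i\<in>I. (w \<bullet> e i) *\<^sub>R e i"
  have "(w - ?s) \<bullet> v = 0" if "v \<in> span (e ` I)" for v
  proof -
    have "(w - ?s) \<bullet> (\<Sum>i\<in>I. (v \<bullet> e i) *\<^sub>R e i) = 0"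
      by (simp add: inner_sum_right inner_diff_left orthonormal_inner_sum[OF assms])
    then show ?thesis using orthonormal_expansion[OF assms that] by simp
  qed
  moreover have "?s \<in> span (e ` I)" by (intro span_sum span_scale span_base) auto
  ultimately show "?s \<in> span (e ` I) \<and> (\<forall>v\<in>span (e ` I). (w - ?s) \<bullet> v = 0)" by blast
next
  fix w' assume w': "w' \<in> span (e ` I) \<and> (\<forall>v\<in>span (e ` I). (w - w') \<bullet> v = 0)"
  then have "w' \<bullet> e i = w \<bullet> e i" if "i \<in> I" for i
    using that by (auto simp: inner_diff_left span_base)
  then have "(\<Sum>i\<in>I. (w' \<bullet> e i) *\<^sub>R e i) = (\<Sum>i\<in>I. (w \<bullet> e i) *\<^sub>R e i)" by simp
  then show "w' = (\<Sum>i\<in>I. (w \<bullet> e i) *\<^sub>R e i)"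
    using orthonormal_expansion[OF assms, of w'] w' by (blast intro: trans)
qed

section \<open>Clusters of Ritz values in an abstract inner product space\<close>

text \<open>The Hilbert space core of the statement. \<open>H\<close> stands for the energy space, \<open>V\<close> for a
finite-dimensional subspace with a complete orthonormal system \<open>uh\<close> of discrete eigenvectors,
indexed by \<open>I\<close>, and \<open>C\<close> for the cluster. The last
assumption separates the exact eigenvalues in the cluster from the discrete ones outside it.\<close>

locale ritz_cluster =
  fixes H V :: "'v::real_inner set" and a :: "'v \<Rightarrow> 'v \<Rightarrow> real"
    and I C :: "nat set" and lam lamh :: "nat \<Rightarrow> real" and u uh :: "nat \<Rightarrow> 'v"
  assumes H: "subspace H" and V: "subspace V" "V \<subseteq> H"
    and a_add: "x \<in> H \<Longrightarrow> y \<in> H \<Longrightarrow> z \<in> H \<Longrightarrow> a (x + y) z = a x z + a y z"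
    and a_scale: "x \<in> H \<Longrightarrow> z \<in> H \<Longrightarrow> a (c *\<^sub>R x) z = c * a x z"
    and a_sym: "a x y = a y x"
    and fin: "finite I" and C: "C \<subseteq> I" "C \<noteq> {}"
    and uh: "orthonormal_on I uh" "V = span (uh ` I)"
    and uh_eigen: "i \<in> I \<Longrightarrow> v \<in> V \<Longrightarrow> a (uh i) v = lamh i * (uh i \<bullet> v)"
    and lamh_pos: "i \<in> I \<Longrightarrow> 0 < lamh i"
    and u: "orthonormal_on C u" "u ` C \<subseteq> H"
    and u_eigen: "j \<in> C \<Longrightarrow> v \<in> H \<Longrightarrow> a (u j) v = lam j * (u j \<bullet> v)"
    and lam_pos: "j \<in> C \<Longrightarrow> 0 < lam j"
    and gap: "j \<in> C \<Longrightarrow> i \<in> I - C \<Longrightarrow> lamh i \<noteq> lam j"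
begin

abbreviation P where "P \<equiv> form_proj a V"
abbreviation Q where "Q \<equiv> form_proj inner (span (uh ` C))"
abbreviation E where "E \<equiv> span (u ` C)"
abbreviation EB where "EB \<equiv> unit_sphere_of E"

definition max_err where "max_err = (SUP v\<in>EB. norm (v - P v))"

lemma finC: "finite C" using fin C finite_subset by auto

lemma uh_V: "i \<in> I \<Longrightarrow> uh i \<in> V" using uh(2) by (simp add: span_base)

lemma uh_H: "i \<in> I \<Longrightarrow> uh i \<in> H" using uh_V V by auto

lemma E_H: "E \<subseteq> H" using u(2) H by (intro span_minimal)

lemma a_0: "z \<in> H \<Longrightarrow> a 0 z = 0"
  using a_scale[of 0 z 0] subspace_0[OF H] by simp

lemma a_sum:
  assumes "finite J" "\<And>i. i \<in> J \<Longrightarrow> x i \<in> H" "z \<in> H"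
  shows "a (\<Sum>i\<in>J. c i *\<^sub>R x i) z = (\<Sum>i\<in>J. c i * a (x i) z)"
  using assms(1,2)
proof (induction J rule: finite_induct)
  case empty
  then show ?case using a_0[OF assms(3)] by simp
next
  case (insert j J)
  have "(\<Sum>i\<in>J. c i *\<^sub>R x i) \<in> H"
    using insert by (intro subspace_sum[OF H] subspace_scale[OF H]) auto
  then show ?case
    using insert assms(3) by (simp add: a_add a_scale subspace_scale[OF H])
qed

text \<open>In the basis \<open>uh\<close> the form \<open>a\<close> is diagonal on \<open>V\<close>, with the positive entries \<open>lamh i\<close>; this gives
existence, uniqueness and linearity of the energy projection.\<close>

lemma P_eq:
  assumes x: "x \<in> H"
  shows "P x = (\<Sum>i\<in>I. (a x (uh i) / lamh i) *\<^sub>R uh i)"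
  unfolding form_proj_def
proof (rule the_equality)
  let ?w = "\<Sum>i\<in>I. (a x (uh i) / lamh i) *\<^sub>R uh i"
  have w: "?w \<in> V" unfolding uh(2) by (intro span_sum span_scale span_base) auto
  have "a (x - ?w) v = 0" if v: "v \<in> V" for v
  proof -
    have vH: "v \<in> H" and wH: "?w \<in> H" using v w V by auto
    have "a ?w v = (\<Sum>i\<in>I. a x (uh i) / lamh i * a (uh i) v)"
      by (rule a_sum[OF fin uh_H vH])
    also have "\<dots> = (\<Sum>i\<in>I. (v \<bullet> uh i) * a (uh i) x)"
    proof (rule sum.cong)
      fix i assume i: "i \<in> I"
      then show "a x (uh i) / lamh i * a (uh i) v = (v \<bullet> uh i) * a (uh i) x"
        using lamh_pos[OF i] by (simp add: uh_eigen[OF i v] a_sym[of x] inner_commute)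
    qed simp
    also have "\<dots> = a (\<Sum>i\<in>I. (v \<bullet> uh i) *\<^sub>R uh i) x"
      by (rule a_sum[OF fin uh_H x, symmetric])
    also have "\<dots> = a x v"
      using orthonormal_expansion[OF fin uh(1)] v uh(2) by (metis a_sym)
    finally have "a ?w v = a x v" .
    moreover have "a (x - ?w) v = a x v - a ?w v"
      using a_add[OF x subspace_neg[OF H wH] vH] a_scale[OF wH vH, of "- 1"] by simp
    ultimately show ?thesis by simp
  qed
  then show "?w \<in> V \<and> (\<forall>v\<in>V. a (x - ?w) v = 0)" using w by simp
next
  fix w assume w: "w \<in> V \<and> (\<forall>v\<in>V. a (x - w) v = 0)"
  then have wH: "w \<in> H" using V by auto
  have "w \<bullet> uh i = a x (uh i) / lamh i" if i: "i \<in> I" for i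
  proof -
    have "a x (uh i) = a w (uh i)"
      using w uh_V[OF i] a_add[OF x subspace_neg[OF H wH] uh_H[OF i]]
        a_scale[OF wH uh_H[OF i], of "- 1"] by simp
    also have "\<dots> = lamh i * (w \<bullet> uh i)"
      using uh_eigen[OF i, of w] w by (simp add: a_sym[of w] inner_commute)
    finally show ?thesis using lamh_pos[OF i] by simp
  qed
  then show "w = (\<Sum>i\<in>I. (a x (uh i) / lamh i) *\<^sub>R uh i)"
    using orthonormal_expansion[OF fin uh(1), of w] w uh(2) by (metis (no_types, lifting) sum.cong)
qed

lemma P_in_V: "x \<in> H \<Longrightarrow> P x \<in> V"
  unfolding P_eq by (subst uh(2)) (intro span_sum span_scale span_base, auto)

lemma P_coeff: "x \<in> H \<Longrightarrow> i \<in> I \<Longrightarrow> lamh i * (P x \<bullet> uh i) = a x (uh i)"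
  using lamh_pos[of i] by (simp add: P_eq orthonormal_inner_sum[OF fin uh(1)])

lemma P_add: "x \<in> H \<Longrightarrow> y \<in> H \<Longrightarrow> P (x + y) = P x + P y"
  by (simp add: P_eq subspace_add[OF H] a_add uh_H add_divide_distrib scaleR_add_left
      sum.distrib cong: sum.cong)

lemma P_scale: "x \<in> H \<Longrightarrow> P (c *\<^sub>R x) = c *\<^sub>R P x"
  by (simp add: P_eq subspace_scale[OF H] a_scale uh_H scaleR_sum_right cong: sum.cong)

lemma P_sum:
  assumes "finite J" "\<And>i. i \<in> J \<Longrightarrow> x i \<in> H"
  shows "P (\<Sum>i\<in>J. c i *\<^sub>R x i) = (\<Sum>i\<in>J. c i *\<^sub>R P (x i))"
  using assms
proof (induction J rule: finite_induct)
  case empty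
  then show ?case using P_scale[OF subspace_0[OF H], of 0] by simp
next
  case (insert j J)
  have "(\<Sum>i\<in>J. c i *\<^sub>R x i) \<in> H"
    using insert by (intro subspace_sum[OF H] subspace_scale[OF H]) auto
  then show ?case
    using insert by (simp add: P_add P_scale subspace_scale[OF H])
qed

lemma residual_eq:
  assumes "x \<in> H"
  shows "P x - Q (P x) = (\<Sum>i\<in>I - C. (P x \<bullet> uh i) *\<^sub>R uh i)"
proof -
  have "P x = (\<Sum>i\<in>I. (P x \<bullet> uh i) *\<^sub>R uh i)"
    using orthonormal_expansion[OF fin uh(1)] P_in_V[OF assms] uh(2) by blast
  also have "\<dots> = (\<Sum>i\<in>I - C. (P x \<bullet> uh i) *\<^sub>R uh i) + (\<Sum>i\<in>C. (P x \<bullet> uh i) *\<^sub>R uh i)"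
    by (rule sum.subset_diff[OF C(1) fin])
  finally show ?thesis
    unfolding inner_form_proj_span[OF finC orthonormal_on_subset[OF uh(1) C(1)], of "P x"]
    by (rule diff_eq_eq[THEN iffD2])
qed

lemma norm_residual:
  assumes "x \<in> H"
  shows "norm (P x - Q (P x)) = L2_set (\<lambda>i. P x \<bullet> uh i) (I - C)"
  unfolding residual_eq[OF assms]
  using fin by (intro orthonormal_norm_sum orthonormal_on_subset[OF uh(1)]) auto

lemma residual_sum:
  assumes "finite J" "\<And>j. j \<in> J \<Longrightarrow> x j \<in> H"
  shows "P (\<Sum>j\<in>J. c j *\<^sub>R x j) - Q (P (\<Sum>j\<in>J. c j *\<^sub>R x j))
    = (\<Sum>j\<in>J. c j *\<^sub>R (P (x j) - Q (P (x j))))"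
proof -
  have "(\<Sum>j\<in>J. c j *\<^sub>R x j) \<in> H"
    using assms by (intro subspace_sum[OF H] subspace_scale[OF H]) auto
  then have "P (\<Sum>j\<in>J. c j *\<^sub>R x j) - Q (P (\<Sum>j\<in>J. c j *\<^sub>R x j))
      = (\<Sum>i\<in>I - C. \<Sum>j\<in>J. c j *\<^sub>R (P (x j) \<bullet> uh i) *\<^sub>R uh i)"
    by (subst residual_eq) (simp_all add: P_sum[OF assms] inner_sum_left scaleR_sum_left)
  also have "\<dots> = (\<Sum>j\<in>J. c j *\<^sub>R (P (x j) - Q (P (x j))))"
    by (subst sum.swap) (simp add: residual_eq assms(2) scaleR_sum_right)
  finally show ?thesis .
qed

lemma E_coeffs:
  assumes "z \<in> E"
  obtains c where "z = (\<Sum>j\<in>C. c j *\<^sub>R u j)" "norm z = L2_set c C"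
  using orthonormal_expansion[OF finC u(1) assms] orthonormal_norm_sum[OF finC u(1)] by metis

lemma sum_abs_le_sqrt_card: "(\<Sum>j\<in>C. \<bar>c j\<bar>) \<le> sqrt (card C) * L2_set c C"
  using L2_set_mult_ineq[of "\<lambda>j. 1" c C] by (simp add: L2_set_def)

lemma u_H: "j \<in> C \<Longrightarrow> u j \<in> H" using u(2) by auto

lemma u_EB: "j \<in> C \<Longrightarrow> u j \<in> EB"
  using u(1) by (auto simp: unit_sphere_of_def span_base orthonormal_on_def norm_eq_sqrt_inner)

lemma EB_nonempty: "EB \<noteq> {}" using u_EB C(2) by auto

lemma norm_err_le_sum:
  assumes "z = (\<Sum>j\<in>C. c j *\<^sub>R u j)"
  shows "norm (z - P z) \<le> (\<Sum>j\<in>C. \<bar>c j\<bar> * norm (u j - P (u j)))"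
proof -
  have "z - P z = (\<Sum>j\<in>C. c j *\<^sub>R (u j - P (u j)))"
    unfolding assms by (simp add: P_sum[OF finC u_H] scaleR_diff_right sum_subtractf)
  then show ?thesis using norm_sum[of "\<lambda>j. c j *\<^sub>R (u j - P (u j))" C] by simp
qed

lemma bdd_err: "bdd_above ((\<lambda>v. norm (v - P v)) ` EB)"
proof (rule bdd_aboveI2)
  fix v assume "v \<in> EB"
  then have v: "v \<in> E" "norm v = 1" by (auto simp: unit_sphere_of_def)
  obtain c where c: "v = (\<Sum>j\<in>C. c j *\<^sub>R u j)" "norm v = L2_set c C" using E_coeffs[OF v(1)] .
  have "\<bar>c j\<bar> \<le> 1" if "j \<in> C" for j
    using member_le_L2_set[OF finC that, of "\<lambda>j. \<bar>c j\<bar>"] c(2) v(2) by (simp add: L2_set_def)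
  then have "(\<Sum>j\<in>C. \<bar>c j\<bar> * norm (u j - P (u j))) \<le> (\<Sum>j\<in>C. 1 * norm (u j - P (u j)))"
    by (intro sum_mono mult_right_mono) auto
  then show "norm (v - P v) \<le> (\<Sum>j\<in>C. norm (u j - P (u j)))"
    using norm_err_le_sum[OF c(1)] by simp
qed

lemma err_le_max: "v \<in> EB \<Longrightarrow> norm (v - P v) \<le> max_err"
  unfolding max_err_def by (rule cSUP_upper[OF _ bdd_err])

text \<open>Both eigenvalue equations evaluate \<open>a (u j) (uh i)\<close>: one as \<open>lam j * (u j \<bullet> uh i)\<close>, the other as
\<open>lamh i * (P (u j) \<bullet> uh i)\<close>. Hence the component of \<open>P (u j)\<close> along \<open>uh i\<close> is controlled by
that of the error \<open>u j - P (u j)\<close>.\<close>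

lemma eigenvector_identity:
  assumes j: "j \<in> C" and i: "i \<in> I - C"
  shows "P (u j) \<bullet> uh i = lam j / (lamh i - lam j) * ((u j - P (u j)) \<bullet> uh i)"
proof -
  have "lamh i * (P (u j) \<bullet> uh i) = lam j * (u j \<bullet> uh i)"
    using i by (simp add: P_coeff[OF u_H[OF j]] u_eigen[OF j uh_H])
  then show ?thesis using gap[OF j i] by (simp add: inner_diff_left field_simps)
qed

text \<open>The identity above and Bessel's inequality bound the residual of each single eigenvector. For a
combination the bounds are added up; by Cauchy--Schwarz the coefficients of a unit vector sum to at
most \<open>sqrt (card C)\<close> in absolute value.\<close>

lemma residual_bound_crude:
  assumes t: "\<And>j i. j \<in> C \<Longrightarrow> i \<in> I - C \<Longrightarrow> lam j / \<bar>lamh i - lam j\<bar> \<le> t" "0 \<le> t"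
    and z: "z \<in> EB"
  shows "norm (P z - Q (P z)) \<le> t * sqrt (card C) * max_err"
proof -
  have each: "norm (P (u j) - Q (P (u j))) \<le> t * max_err" if j: "j \<in> C" for j
  proof -
    have "norm (P (u j) - Q (P (u j))) \<le> L2_set (\<lambda>i. t * \<bar>(u j - P (u j)) \<bullet> uh i\<bar>) (I - C)"
      unfolding norm_residual[OF u_H[OF j]] L2_set_def
    proof (intro real_sqrt_le_mono sum_mono)
      fix i assume i: "i \<in> I - C"
      have "\<bar>lam j / (lamh i - lam j)\<bar> \<le> t"
        using t(1)[OF j i] lam_pos[OF j] by (simp add: abs_divide)
      then have "\<bar>P (u j) \<bullet> uh i\<bar> \<le> t * \<bar>(u j - P (u j)) \<bullet> uh i\<bar>"
        unfolding eigenvector_identity[OF j i] abs_mult by (rule mult_right_mono) simp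
      then show "(P (u j) \<bullet> uh i)\<^sup>2 \<le> (t * \<bar>(u j - P (u j)) \<bullet> uh i\<bar>)\<^sup>2"
        using power_mono[of "\<bar>P (u j) \<bullet> uh i\<bar>" _ 2] by simp
    qed
    also have "\<dots> = t * L2_set (\<lambda>i. (u j - P (u j)) \<bullet> uh i) (I - C)"
      by (rule L2_set_scale_abs[OF t(2)])
    also have "\<dots> \<le> t * norm (u j - P (u j))"
      using fin t(2)
      by (intro mult_left_mono bessel_inequality orthonormal_on_subset[OF uh(1)]) auto
    also have "\<dots> \<le> t * max_err" by (intro mult_left_mono err_le_max u_EB j t(2))
    finally show ?thesis .
  qed
  have "0 \<le> max_err" using err_le_max[OF z] norm_ge_zero order_trans by blast
  obtain c where c: "z = (\<Sum>j\<in>C. c j *\<^sub>R u j)" "norm z = L2_set c C"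
    using E_coeffs z by (auto simp: unit_sphere_of_def)
  have "norm (P z - Q (P z)) \<le> (\<Sum>j\<in>C. \<bar>c j\<bar> * norm (P (u j) - Q (P (u j))))"
    unfolding c(1)
    by (subst residual_sum[OF finC u_H], assumption, rule order_trans[OF norm_sum]) simp
  also have "\<dots> \<le> (\<Sum>j\<in>C. \<bar>c j\<bar> * (t * max_err))"
    by (intro sum_mono mult_left_mono each) auto
  also have "\<dots> = (\<Sum>j\<in>C. \<bar>c j\<bar>) * (t * max_err)" by (simp add: sum_distrib_right)
  also have "\<dots> \<le> sqrt (card C) * (t * max_err)"
    using sum_abs_le_sqrt_card[of c] c(2) z t(2) \<open>0 \<le> max_err\<close>
    by (intro mult_right_mono) (auto simp: unit_sphere_of_def)
  finally show ?thesis by (simp add: mult.commute mult.left_commute)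
qed

text \<open>The analogue of the eigenvector identity for a combination \<open>z\<close>, with the single reference eigenvalue
\<open>lam n\<close> in place of all \<open>lam j\<close>. Since \<open>a z (uh i) - a y (uh i) = lam n * (z \<bullet> uh i)\<close> for the
chosen weights in \<open>y\<close>, the vector \<open>y\<close> carries the whole correction, and it is small if
the eigenvalues of the cluster are close to \<open>lam n\<close>.\<close>

lemma cluster_identity:
  assumes n: "n \<in> C" and i: "i \<in> I - C" and z: "z = (\<Sum>j\<in>C. c j *\<^sub>R u j)"
    and y: "y = (\<Sum>j\<in>C. (c j * ((lam j - lam n) / lam j)) *\<^sub>R u j)"
  shows "P z \<bullet> uh i = lam n / (lamh i - lam n) * ((z - P z) \<bullet> uh i)
    + lamh i / (lamh i - lam n) * (P y \<bullet> uh i)"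
proof -
  have iI: "i \<in> I" using i by simp
  have H': "z \<in> H" "y \<in> H"
    unfolding z y by (intro subspace_sum[OF H] subspace_scale[OF H] u_H; simp)+
  have "lamh i * (P z \<bullet> uh i) = (\<Sum>j\<in>C. c j * (lam j * (u j \<bullet> uh i)))"
    unfolding P_coeff[OF H'(1) iI] unfolding z
    by (simp add: a_sum[OF finC u_H uh_H[OF iI]] u_eigen uh_H[OF iI])
  moreover have "lamh i * (P y \<bullet> uh i) = (\<Sum>j\<in>C. c j * ((lam j - lam n) * (u j \<bullet> uh i)))"
    unfolding P_coeff[OF H'(2) iI] unfolding y
    by (subst a_sum[OF finC u_H uh_H[OF iI]], assumption, rule sum.cong)
       (auto simp: u_eigen uh_H[OF iI] dest: lam_pos)
  moreover have "lam n * (z \<bullet> uh i) = (\<Sum>j\<in>C. c j * (lam n * (u j \<bullet> uh i)))"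
    unfolding z by (simp add: inner_sum_left sum_distrib_left mult.left_commute)
  ultimately have "lamh i * (P z \<bullet> uh i) = lamh i * (P y \<bullet> uh i) + lam n * (z \<bullet> uh i)"
    by (simp add: sum.distrib[symmetric] algebra_simps)
  then have "P z \<bullet> uh i * (lamh i - lam n) = lam n * ((z - P z) \<bullet> uh i) + lamh i * (P y \<bullet> uh i)"
    by (simp add: inner_diff_left algebra_simps)
  then have "P z \<bullet> uh i = (lam n * ((z - P z) \<bullet> uh i) + lamh i * (P y \<bullet> uh i)) / (lamh i - lam n)"
    using gap[OF n i] by (simp add: eq_divide_eq)
  then show ?thesis by (simp add: add_divide_distrib)
qed

text \<open>The vector \<open>y\<close> of the preceding identity lies in \<open>E\<close> and has norm at most \<open>r\<close> when \<open>z\<close> is a unit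
vector. Hence the supremum \<open>S\<close> of the residuals over the unit sphere of \<open>E\<close> satisfies
\<open>S \<le> t * max_err + th * r * S\<close>. Its finiteness, the hypothesis \<open>bdd_above\<close>, allows the last term to
be absorbed into the left-hand side.\<close>

lemma residual_bound_sharp:
  assumes n: "n \<in> C"
    and t: "\<And>i. i \<in> I - C \<Longrightarrow> lam n / \<bar>lamh i - lam n\<bar> \<le> t" "0 \<le> t"
    and th: "\<And>i. i \<in> I - C \<Longrightarrow> lamh i / \<bar>lamh i - lam n\<bar> \<le> th" "0 \<le> th"
    and bdd: "bdd_above ((\<lambda>z. norm (P z - Q (P z))) ` EB)"
    and r: "\<And>j. j \<in> C \<Longrightarrow> \<bar>(lam j - lam n) / lam j\<bar> \<le> r" "0 \<le> r" "th * r < 1"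
    and z: "z \<in> EB"
  shows "norm (P z - Q (P z)) \<le> t / (1 - th * r) * max_err"
proof -
  let ?R = "\<lambda>z. norm (P z - Q (P z))"
  define S where "S = (SUP z\<in>EB. ?R z)"
  have rS: "?R w \<le> S" if "w \<in> EB" for w
    unfolding S_def using that by (rule cSUP_upper[OF _ bdd])
  then have S0: "0 \<le> S" using z norm_ge_zero order_trans by blast
  have rE: "?R w \<le> norm w * S" if w: "w \<in> E" for w
  proof (cases "w = 0")
    case True
    then show ?thesis using residual_sum[of "{}"] by simp
  next
    case False
    have wH: "w \<in> H" using w E_H by auto
    have "?R ((1 / norm w) *\<^sub>R w) \<le> S"
      using w False by (intro rS) (simp add: unit_sphere_of_def span_scale)
    moreover have "P ((1 / norm w) *\<^sub>R w) - Q (P ((1 / norm w) *\<^sub>R w))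
        = (1 / norm w) *\<^sub>R (P w - Q (P w))"
      using residual_sum[of "{0::nat}" "\<lambda>_. w" "\<lambda>_. 1 / norm w"] wH by simp
    ultimately show ?thesis using False by (simp add: divide_le_eq mult.commute)
  qed
  have "?R w \<le> t * max_err + th * (r * S)" if w: "w \<in> EB" for w
  proof -
    obtain c where c: "w = (\<Sum>j\<in>C. c j *\<^sub>R u j)" "norm w = L2_set c C"
      using E_coeffs w by (auto simp: unit_sphere_of_def)
    define y where "y = (\<Sum>j\<in>C. (c j * ((lam j - lam n) / lam j)) *\<^sub>R u j)"
    have y: "y \<in> E" unfolding y_def by (intro span_sum span_scale span_base) auto
    have wH: "w \<in> H" and yH: "y \<in> H" using w y E_H by (auto simp: unit_sphere_of_def)
    have "norm y = L2_set (\<lambda>j. c j * ((lam j - lam n) / lam j)) C"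
      unfolding y_def by (rule orthonormal_norm_sum[OF finC u(1)])
    also have "\<dots> \<le> L2_set (\<lambda>j. r * \<bar>c j\<bar>) C"
      unfolding L2_set_def
    proof (intro real_sqrt_le_mono sum_mono)
      fix j assume "j \<in> C"
      then have "\<bar>c j * ((lam j - lam n) / lam j)\<bar> \<le> r * \<bar>c j\<bar>"
        unfolding abs_mult using r(1) by (subst mult.commute) (intro mult_right_mono, auto)
      then show "(c j * ((lam j - lam n) / lam j))\<^sup>2 \<le> (r * \<bar>c j\<bar>)\<^sup>2"
        unfolding abs_le_square_iff[symmetric] by (rule order_trans[OF _ abs_ge_self])
    qed
    also have "\<dots> = r * L2_set c C"
      by (rule L2_set_scale_abs[OF r(2)])
    finally have ynorm: "norm y \<le> r" using c(2) w by (simp add: unit_sphere_of_def)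
    have "?R w = L2_set (\<lambda>i. P w \<bullet> uh i) (I - C)" by (rule norm_residual[OF wH])
    also have "\<dots> \<le> L2_set (\<lambda>i. t * \<bar>(w - P w) \<bullet> uh i\<bar> + th * \<bar>P y \<bullet> uh i\<bar>) (I - C)"
      unfolding L2_set_def
    proof (intro real_sqrt_le_mono sum_mono)
      fix i assume i: "i \<in> I - C"
      have "\<bar>P w \<bullet> uh i\<bar> \<le> \<bar>lam n / (lamh i - lam n)\<bar> * \<bar>(w - P w) \<bullet> uh i\<bar>
          + \<bar>lamh i / (lamh i - lam n)\<bar> * \<bar>P y \<bullet> uh i\<bar>"
        unfolding cluster_identity[OF n i c(1) y_def] abs_mult[symmetric] by (rule abs_triangle_ineq)
      also have "\<dots> \<le> t * \<bar>(w - P w) \<bullet> uh i\<bar> + th * \<bar>P y \<bullet> uh i\<bar>"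
        using t(1)[OF i] th(1)[OF i] lam_pos[OF n] lamh_pos[of i] i
        by (intro add_mono mult_right_mono) (auto simp: abs_divide)
      finally show "(P w \<bullet> uh i)\<^sup>2 \<le> (t * \<bar>(w - P w) \<bullet> uh i\<bar> + th * \<bar>P y \<bullet> uh i\<bar>)\<^sup>2"
        using power_mono[of "\<bar>P w \<bullet> uh i\<bar>" _ 2] by simp
    qed
    also have "\<dots> \<le> L2_set (\<lambda>i. t * \<bar>(w - P w) \<bullet> uh i\<bar>) (I - C)
        + L2_set (\<lambda>i. th * \<bar>P y \<bullet> uh i\<bar>) (I - C)"
      by (rule L2_set_triangle_ineq)
    also have "\<dots> = t * L2_set (\<lambda>i. (w - P w) \<bullet> uh i) (I - C) + th * ?R y"
      using t(2) th(2)
      by (simp add: norm_residual[OF yH] L2_set_scale_abs)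
    also have "\<dots> \<le> t * norm (w - P w) + th * (norm y * S)"
      using fin t(2) th(2) y
      by (intro add_mono mult_left_mono bessel_inequality orthonormal_on_subset[OF uh(1)] rE) auto
    also have "\<dots> \<le> t * max_err + th * (r * S)"
      by (intro add_mono mult_left_mono mult_right_mono err_le_max w ynorm S0 t(2) th(2))
    finally show ?thesis .
  qed
  then have "S \<le> t * max_err + th * (r * S)"
    unfolding S_def[of ] by (intro cSUP_least EB_nonempty) (simp add: S_def)
  then have "S * (1 - th * r) \<le> t * max_err" by (simp add: algebra_simps)
  then have "S \<le> t * max_err / (1 - th * r)"
    using r(3) by (simp add: pos_le_divide_eq)
  then show ?thesis using rS[OF z] by simp
qed

end

section \<open>Bounds on \<open>beta\<close>\<close>

text \<open>A bound on \<open>beta\<close> needs more than a member of the set of admissible constants: \<open>LEAST\<close> is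
meaningful only if that set has a minimum. It does, namely the quotient of the suprema of the
residuals and of the projection errors; the latter is positive in the nontrivial case.\<close>

lemma beta_le:
  assumes K: "0 \<le> K"
    and bdd: "bdd_above ((\<lambda>v. norm (v - energy_proj \<Omega> V v)) ` unit_sphere_of E)"
    and bound: "\<And>z. z \<in> unit_sphere_of E \<Longrightarrow>
      norm (energy_proj \<Omega> V z - L2_proj Eh (energy_proj \<Omega> V z))
        \<le> K * (SUP v\<in>unit_sphere_of E. norm (v - energy_proj \<Omega> V v))"
  shows "beta \<Omega> V E Eh \<le> K"
proof -
  let ?P = "energy_proj \<Omega> V" and ?EB = "unit_sphere_of E"
  let ?f = "\<lambda>z. norm (?P z - L2_proj Eh (?P z))"
  define m where "m = (SUP v\<in>?EB. norm (v - ?P v))"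
  show ?thesis
  proof (cases "\<forall>u\<in>?EB. norm (u - ?P u) = 0")
    case True
    then show ?thesis using K by (simp add: beta_def)
  next
    case False
    then obtain v where v: "v \<in> ?EB" "0 < norm (v - ?P v)" by auto
    have "norm (v - ?P v) \<le> m" unfolding m_def by (rule cSUP_upper[OF v(1) bdd])
    then have m: "0 < m" using v(2) by linarith
    define S where "S = (SUP z\<in>?EB. ?f z)"
    have bdd_f: "bdd_above (?f ` ?EB)"
      using bound unfolding m_def[symmetric] by (rule bdd_aboveI2)
    have fS: "?f z \<le> S" if "z \<in> ?EB" for z unfolding S_def by (rule cSUP_upper[OF that bdd_f])
    have "0 \<le> S" using fS[OF v(1)] norm_ge_zero order_trans by blast
    have S_le: "S \<le> b * m" if "\<forall>z\<in>?EB. ?f z \<le> b * m" for b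
      unfolding S_def using v(1) that by (intro cSUP_least) auto
    have "(LEAST b. 0 \<le> b \<and> (\<forall>z\<in>?EB. ?f z \<le> b * m)) = S / m"
    proof (rule Least_equality)
      show "0 \<le> S / m \<and> (\<forall>z\<in>?EB. ?f z \<le> S / m * m)"
        using fS \<open>0 \<le> S\<close> m by simp
      show "S / m \<le> b" if "0 \<le> b \<and> (\<forall>z\<in>?EB. ?f z \<le> b * m)" for b
        using S_le[of b] that m by (simp add: pos_divide_le_eq)
    qed
    then have "beta \<Omega> V E Eh = S / m"
      unfolding beta_def Let_def m_def[symmetric] if_not_P[OF False] .
    also have "\<dots> \<le> K"
      using S_le[of K] bound m by (simp add: pos_divide_le_eq m_def)
    finally show ?thesis .
  qed
qed

lemma Max0_upper: "finite S \<Longrightarrow> x \<in> S \<Longrightarrow> x \<le> Max0 S"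
  by (auto simp: Max0_def)

lemma Max0_nonneg: "finite S \<Longrightarrow> (\<And>x. x \<in> S \<Longrightarrow> 0 \<le> x) \<Longrightarrow> 0 \<le> Max0 S"
  using Max_in[of S] by (auto simp: Max0_def)

section \<open>The energy form\<close>

lemma H10_subset_H1: "H10 \<Omega> \<subseteq> H1 \<Omega>"
  by (auto simp: H10_def)

lemma energy_add:
  assumes "open \<Omega>" "x \<in> H10 \<Omega>" "y \<in> H10 \<Omega>"
  shows "energy \<Omega> (x + y) z = energy \<Omega> x z + energy \<Omega> y z"
  using assms by (simp add: energy_def grad_add subsetD[OF H10_subset_H1] inner_add_left)

lemma energy_scaleR:
  assumes "open \<Omega>" "x \<in> H10 \<Omega>"
  shows "energy \<Omega> (c *\<^sub>R x) z = c * energy \<Omega> x z"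
  using assms by (simp add: energy_def grad_scaleR subsetD[OF H10_subset_H1])

text \<open>A vector with vanishing gradient would be an eigenvector with eigenvalue \<open>0\<close>. All eigenvalues are
positive and every eigenvector lies in the span of the \<open>u i\<close> with the same eigenvalue, so such a
vector is \<open>0\<close>. This takes the place of a Poincare inequality.\<close>

lemma energy_pos:
  assumes ev: "dirichlet_eigenpairs \<Omega> lam u" and w: "w \<in> H10 \<Omega>" "w \<noteq> 0"
  shows "0 < energy \<Omega> w w"
proof (rule ccontr)
  assume "\<not> 0 < energy \<Omega> w w"
  then have "grad \<Omega> w = 0" by (simp add: energy_def)
  then have "\<forall>v\<in>H10 \<Omega>. energy \<Omega> w v = 0 * (w \<bullet> v)" by (simp add: energy_def)
  then have "w \<in> span {u i | i. 1 \<le> i \<and> lam i = 0}"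
    using ev w(1) unfolding dirichlet_eigenpairs_def by blast
  moreover have "{u i | i. 1 \<le> i \<and> lam i = 0} = {}"
    using ev unfolding dirichlet_eigenpairs_def by force
  ultimately show False using w(2) by (simp only: span_empty singleton_iff)
qed

section \<open>Eigenvalue clusters of the Dirichlet Laplacian\<close>

theorem lemma1:
  fixes \<Omega> :: "(real ^ 'd) set" and \<T> :: "(real ^ 'd) set set" and p n N :: nat
    and lam lamh :: "nat \<Rightarrow> real" and u uh :: "nat \<Rightarrow> (real ^ 'd, real) l2"
  defines "V \<equiv> fe_space \<Omega> \<T> p"
    and "I \<equiv> {1..dim (fe_space \<Omega> \<T> p)}"
    and "C \<equiv> {n..N}"
    and "E \<equiv> span (u ` {n..N})"
    and "Eh \<equiv> span (uh ` {n..N})"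
  assumes "lipschitz_polytope \<Omega>"
    and "conforming_mesh \<Omega> \<T>"
    and "dirichlet_eigenpairs \<Omega> lam u"
    and "discrete_eigenpairs \<Omega> V lamh uh"
    and "1 \<le> n" and "n \<le> N" and "N \<le> dim V"
    and "n - 1 \<in> I \<Longrightarrow> lamh (n - 1) < lam n"
    and "N + 1 \<in> I \<Longrightarrow> lam N < lamh (N + 1)"
  shows "beta \<Omega> V E Eh \<le> tau lam lamh I C * sqrt (card C) \<and>
    (tau_h lam lamh I C * xi lam n N < 1 - 1 / sqrt (card C) \<longrightarrow>
       beta \<Omega> V E Eh \<le> tau lam lamh I C / (1 - tau_h lam lamh I C * xi lam n N))"
proof -
  have op: "open \<Omega>" using \<open>lipschitz_polytope \<Omega>\<close> by (simp add: lipschitz_polytope_def)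
  have I: "I = {1..dim V}" by (simp add: I_def V_def)
  have CI: "C \<subseteq> I" using \<open>1 \<le> n\<close> \<open>N \<le> dim V\<close> by (auto simp: C_def I)
  have nC: "n \<in> C" and NC: "N \<in> C" using \<open>n \<le> N\<close> by (auto simp: C_def)
  have C1: "1 \<le> j" if "j \<in> C" for j using that \<open>1 \<le> n\<close> by (simp add: C_def)
  note ev = \<open>dirichlet_eigenpairs \<Omega> lam u\<close>[unfolded dirichlet_eigenpairs_def]
  note lam = ev[THEN conjunct1] ev[THEN conjunct2, THEN conjunct1]
  note u_eig = ev[THEN conjunct2, THEN conjunct2, THEN conjunct1]
  note u_on = ev[THEN conjunct2, THEN conjunct2, THEN conjunct2, THEN conjunct1]
  note evh = \<open>discrete_eigenpairs \<Omega> V lamh uh\<close>[unfolded discrete_eigenpairs_def, folded I]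
  note lamh_mono = evh[THEN conjunct1]
  note uh_eig = evh[THEN conjunct2, THEN conjunct1]
  note uh_on = evh[THEN conjunct2, THEN conjunct2, THEN conjunct1]
  have lam_pos: "0 < lam j" if "j \<in> C" for j using lam(1) C1[OF that] by simp
  have lam_mono: "lam i \<le> lam j" if "i \<in> C" "i \<le> j" for i j
    using lam(2) C1[OF that(1)] that(2) by simp
  have V: "subspace V" unfolding V_def by (rule subspace_fe_space[OF op])
  have VH: "V \<subseteq> H10 \<Omega>" by (auto simp: V_def fe_space_def)
  have uhV: "uh ` I \<subseteq> V" using uh_eig by auto
  have on_uh: "orthonormal_on I uh" using uh_on by (simp only: orthonormal_on_def)
  have "V \<subseteq> span (uh ` I)"
    using \<open>1 \<le> n\<close> \<open>n \<le> N\<close> \<open>N \<le> dim V\<close>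
    by (intro orthonormal_spans[OF _ on_uh uhV]) (simp_all add: I)
  then have span_uh: "V = span (uh ` I)" using span_minimal[OF uhV V] by blast
  have lamh_pos: "0 < lamh i" if i: "i \<in> I" for i
  proof -
    have uh_i: "uh i \<in> V" "uh i \<bullet> uh i = 1" using uh_eig uh_on i by auto
    then have "uh i \<noteq> 0" by auto
    then have "0 < energy \<Omega> (uh i) (uh i)"
      using energy_pos[OF \<open>dirichlet_eigenpairs \<Omega> lam u\<close>] uh_i(1) VH by auto
    also have "energy \<Omega> (uh i) (uh i) = lamh i" using uh_eig i uh_i by simp
    finally show ?thesis .
  qed
  have gap: "lamh i \<noteq> lam j" if j: "j \<in> C" and i: "i \<in> I - C" for i j
  proof (cases "i < n")
    case True
    then have le: "i \<le> n - 1" and I': "n - 1 \<in> I" "i \<in> I" using i nC CI by (auto simp: I)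
    have "lamh i \<le> lamh (n - 1)" using lamh_mono I' le by blast
    also have "\<dots> < lam n" using I'(1) by (rule assms(13))
    also have "\<dots> \<le> lam j" using j by (intro lam_mono nC) (simp add: C_def)
    finally show ?thesis by simp
  next
    case False
    then have le: "N + 1 \<le> i" and I': "N + 1 \<in> I" "i \<in> I" using i by (auto simp: I C_def)
    have "lam j \<le> lam N" using j by (intro lam_mono j) (simp add: C_def)
    also have "\<dots> < lamh (N + 1)" using I'(1) by (rule assms(14))
    also have "\<dots> \<le> lamh i" using lamh_mono I' le by blast
    finally show ?thesis by simp
  qed
  interpret ritz_cluster "H10 \<Omega>" V "energy \<Omega>" I C lam lamh u uh
  proof
    show "orthonormal_on C u" using u_on C1 by (simp add: orthonormal_on_def)
    show "u ` C \<subseteq> H10 \<Omega>" using u_eig C1 by auto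
    show "energy \<Omega> (u j) v = lam j * (u j \<bullet> v)" if "j \<in> C" "v \<in> H10 \<Omega>" for j v
      using u_eig C1[OF that(1)] that(2) by simp
    show "energy \<Omega> (uh i) v = lamh i * (uh i \<bullet> v)" if "i \<in> I" "v \<in> V" for i v
      using uh_eig that by simp
    show "energy \<Omega> x y = energy \<Omega> y x" for x y by (simp add: energy_def inner_commute)
    show "energy \<Omega> (x + y) z = energy \<Omega> x z + energy \<Omega> y z" if "x \<in> H10 \<Omega>" "y \<in> H10 \<Omega>" for x y z
      by (rule energy_add[OF op that])
    show "energy \<Omega> (c *\<^sub>R x) z = c * energy \<Omega> x z" if "x \<in> H10 \<Omega>" for c x z
      by (rule energy_scaleR[OF op that])
    show "C \<noteq> {}" using nC by blast
    show "finite I" by (simp add: I)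
  qed (fact subspace_H10[OF op] V VH CI on_uh span_uh lam_pos lamh_pos gap)+
  have E: "E = span (u ` C)" and Eh: "Eh = span (uh ` C)" by (simp_all add: E_def Eh_def C_def)
  let ?t = "tau lam lamh I C" and ?th = "tau_h lam lamh I C" and ?r = "xi lam n N"
  have fin2: "finite {f j i | j i. j \<in> C \<and> i \<in> I - C}" for f :: "nat \<Rightarrow> nat \<Rightarrow> real"
    using fin finC by (intro finite_image_set2) auto
  have t: "lam j / \<bar>lamh i - lam j\<bar> \<le> ?t" if "j \<in> C" "i \<in> I - C" for j i
    unfolding tau_def using that by (intro Max0_upper fin2) blast
  have th: "lamh i / \<bar>lamh i - lam j\<bar> \<le> ?th" if "j \<in> C" "i \<in> I - C" for j i
    unfolding tau_h_def using that by (intro Max0_upper fin2) blast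
  have t0: "0 \<le> ?t"
    unfolding tau_def by (rule Max0_nonneg[OF fin2]) (auto simp: less_imp_le[OF lam_pos])
  have th0: "0 \<le> ?th"
    unfolding tau_h_def by (rule Max0_nonneg[OF fin2]) (auto simp: less_imp_le[OF lamh_pos])
  have crude: "norm (P z - Q (P z)) \<le> ?t * sqrt (card C) * max_err" if "z \<in> EB" for z
    by (rule residual_bound_crude[OF _ t0 that]) (rule t)
  have "beta \<Omega> V E Eh \<le> ?t * sqrt (card C)"
    unfolding E Eh
  proof (rule beta_le[OF _ bdd_err])
    show "0 \<le> ?t * sqrt (card C)" using t0 by simp
    show "norm (P z - Q (P z)) \<le> ?t * sqrt (card C) * (SUP v\<in>EB. norm (v - P v))"
      if "z \<in> EB" for z
      using crude[OF that] by (simp only: max_err_def)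
  qed
  moreover have "beta \<Omega> V E Eh \<le> ?t / (1 - ?th * ?r)" if small: "?th * ?r < 1 - 1 / sqrt (card C)"
  proof -
    have "0 \<le> 1 / sqrt (card C)" by simp
    then have lt1: "?th * ?r < 1" using small by linarith
    \<comment> \<open>The weight has \<open>lam j\<close> in the denominator, \<open>xi\<close> the smaller \<open>lam n\<close>.\<close>
    have r: "\<bar>(lam j - lam n) / lam j\<bar> \<le> ?r" if j: "j \<in> C" for j
    proof -
      have "0 < lam n" "lam n \<le> lam j" "lam j \<le> lam N"
        using j nC by (auto simp: C_def intro: lam_pos lam_mono)
      then show ?thesis by (auto simp: xi_def abs_divide intro!: frac_le)
    qed
    have r0: "0 \<le> ?r" using r[OF nC] by simp
    show ?thesis
      unfolding E Eh
    proof (rule beta_le[OF _ bdd_err])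
      show "0 \<le> ?t / (1 - ?th * ?r)" using t0 lt1 by simp
      show "norm (P z - Q (P z)) \<le> ?t / (1 - ?th * ?r) * (SUP v\<in>EB. norm (v - P v))"
        if "z \<in> EB" for z
        unfolding max_err_def[symmetric]
        by (rule residual_bound_sharp[OF nC t[OF nC] t0 th[OF nC] th0 bdd_aboveI2[OF crude] r r0 lt1 that])
    qed
  qed
  ultimately show ?thesis by blast
qed

end
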